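(* Let $d\ge1$, $J\ge2$, let $\mu_0,\dots,\mu_{J-1}$ be $J$ finite Gaussian mixtures on $\mathbb{R}^d$, and let $\lambda_0,\dots,\lambda_{J-1}$ be positive weights summing to $1$. Then the barycenter problem $$\inf_{\nu \in GMM_d(\infty)} \sum_{j=0}^{J-1} \lambda_j MW_2^2(\mu_j,\nu)$$ has a solution given by $\nu^*=B\#\gamma^*$, where $\gamma^*$ is an optimal plan for the multi-marginal problem $$\inf_{\gamma\in\Pi(\mu_0,\dots,\mu_{J-1})\cap GMM_{Jd}(\infty)}\int_{(\mathbb{R}^d)^J} c(x_0,\dots,x_{J-1})\,d\gamma(x_0,\dots,x_{J-1}).$$
   Context: Gaussian distributions $\mathcal{N}(m,\Sigma)$ on $\mathbb{R}^n$ may be degenerate ($\Sigma$ symmetric positive semi-definite). $GMM_n(\infty)$ is the set of finite Gaussian mixtures on $\mathbb{R}^n$, i.e. finite convex combinations of Gaussian distributions. $\Pi(\mu_0,\dots,\mu_{J-1})$ is the set of probability measures on $(\mathbb{R}^d)^J\cong\mathbb{R}^{Jd}$ with marginals $\mu_0,\dots,\mu_{J-1}$. $T\#\mu$ is the push-forward of $\mu$ by $T$. With the weights $\lambda_j$ fixed, $B:(\mathbb{R}^d)^J\to\mathbb{R}^d$ is $B(x)=\sum_{i=0}^{J-1}\lambda_i x_i$ and $$c(x_0,\dots,x_{J-1})=\sum_{i=0}^{J-1}\lambda_i\|x_i-B(x)\|^2=\tfrac12\sum_{i,j=0}^{J-1}\lambda_i\lambda_j\|x_i-x_j\|^2 .$$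 For finite Gaussian mixtures $\mu,\nu$ on $\mathbb{R}^d$, $$MW_2^2(\mu,\nu) := \inf_{\gamma \in \Pi(\mu,\nu) \cap GMM_{2d}(\infty)} \int_{\mathbb{R}^d\times\mathbb{R}^d} \|y_0-y_1\|^2d\gamma(y_0,y_1).$$ *)

theory Defs
  imports "HOL-Probability.Probability"
begin

text \<open>
  The Euclidean spaces involved are the types \<open>real ^ 'd\<close> (for \<open>R\<^sup>d\<close>),
  \<open>(real ^ 'd) \<times> (real ^ 'd)\<close> (for \<open>R\<^sup>2\<^sup>d\<close>) and \<open>(real ^ 'd) ^ 'j\<close> (for \<open>R\<^sup>J\<^sup>d\<close>, with
  \<open>J = CARD('j)\<close>). All three are instances of \<^class>\<open>euclidean_space\<close>, so Gaussians and Gaussian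
  mixtures are defined once over that class; a covariance matrix becomes a linear operator.
\<close>

definition covariance_operator :: "('a::euclidean_space \<Rightarrow> 'a) \<Rightarrow> bool" where
  "covariance_operator S \<longleftrightarrow>
     linear S \<and> (\<forall>x y. S x \<bullet> y = x \<bullet> S y) \<and> (\<forall>x. 0 \<le> x \<bullet> S x)"

text \<open>
  \<open>gaussian m S M\<close> says that \<open>M\<close> is the law \<open>N(m, S)\<close>. Since \<open>S\<close> may be singular there need not be
  a Lebesgue density, so the law is specified by its characteristic function.
\<close>

definition gaussian :: "'a::euclidean_space \<Rightarrow> ('a \<Rightarrow> 'a) \<Rightarrow> 'a measure \<Rightarrow> bool" where
  "gaussian m S M \<longleftrightarrow>
     covariance_operator S \<and> prob_space M \<and> sets M = sets borel \<and>
     (\<forall>t. (CLINT x|M. iexp (t \<bullet> x)) =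
          exp (\<i> * complex_of_real (t \<bullet> m) - complex_of_real (t \<bullet> S t) / 2))"

lemma gaussian_return: "gaussian m (\<lambda>_. 0) (return borel m)"
  by (auto simp: gaussian_def covariance_operator_def integral_return
      intro!: linearI prob_space_return)

lemma gaussian_normal_density:
  assumes "\<sigma> > 0"
  shows "gaussian m (\<lambda>x. \<sigma>\<^sup>2 * x) (density lborel (\<lambda>x. ennreal (normal_density m \<sigma> x)))"
    (is "gaussian m ?S ?N")
proof -
  let ?Z = std_normal_distribution
  interpret Z: prob_space ?Z
    by (rule prob_space_normal_density) simp
  have "distributed ?Z lborel (\<lambda>x. x) std_normal_density"
    by (simp add: distributed_def distr_id2)
  from Z.normal_density_affine[OF this, of \<sigma> m] assms
  have "distributed ?Z lborel (\<lambda>x. m + \<sigma> * x) (normal_density m \<sigma>)"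
    by simp
  then have N: "?N = distr ?Z borel (\<lambda>x. m + \<sigma> * x)"
    by (simp add: distributed_def cong: distr_cong)
  have "(CLINT x|?N. iexp (t * x)) =
      exp (\<i> * complex_of_real (t * m) - complex_of_real (t * (\<sigma>\<^sup>2 * t)) / 2)" for t
  proof -
    have "(CLINT x|?N. iexp (t * x)) = (CLINT x|?Z. iexp (t * (m + \<sigma> * x)))"
      unfolding N by (subst integral_distr) auto
    also have "\<dots> = (CLINT x|?Z. iexp (t * m) * iexp ((t * \<sigma>) * x))"
      by (intro Bochner_Integration.integral_cong)
        (auto simp: algebra_simps simp flip: exp_add)
    also have "\<dots> = iexp (t * m) * char ?Z (t * \<sigma>)"
      by (simp add: char_def)
    also have "\<dots> = iexp (t * m) * exp (complex_of_real (- ((t * \<sigma>)\<^sup>2) / 2))"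
      by (simp only: char_std_normal_distribution exp_of_real)
    also have "\<dots> = exp (\<i> * complex_of_real (t * m) - complex_of_real (t * (\<sigma>\<^sup>2 * t)) / 2)"
      by (simp add: power2_eq_square algebra_simps flip: exp_add)
    finally show ?thesis .
  qed
  moreover have "covariance_operator ?S"
  proof -
    have "0 \<le> x * (\<sigma>\<^sup>2 * x)" for x
      using zero_le_square[of "\<sigma> * x"] by (simp add: power2_eq_square mult_ac)
    then show ?thesis
      by (auto simp: covariance_operator_def distrib_left intro!: linearI)
  qed
  ultimately show ?thesis
    using prob_space_normal_density[OF assms] by (simp add: gaussian_def)
qed

definition GMM :: "'a::euclidean_space measure set" where
  "GMM = {M. \<exists>(K::nat) w G.
     (\<forall>k<K. 0 \<le> w k \<and> (\<exists>m S. gaussian m S (G k))) \<and> (\<Sum>k<K. w k) = 1 \<and>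
     sets M = sets borel \<and>
     (\<forall>A\<in>sets borel. emeasure M A = (\<Sum>k<K. ennreal (w k) * emeasure (G k) A))}"

definition couplings :: "'a::euclidean_space measure \<Rightarrow> 'a measure \<Rightarrow> ('a \<times> 'a) measure set" where
  "couplings \<mu> \<nu> = {\<gamma>. prob_space \<gamma> \<and> sets \<gamma> = sets borel \<and>
     distr \<gamma> borel fst = \<mu> \<and> distr \<gamma> borel snd = \<nu>}"

definition multi_couplings ::
    "('j::finite \<Rightarrow> 'a::euclidean_space measure) \<Rightarrow> ('a ^ 'j) measure set" where
  "multi_couplings \<mu> = {\<gamma>. prob_space \<gamma> \<and> sets \<gamma> = sets borel \<and>
     (\<forall>j. distr \<gamma> borel (\<lambda>x. x $ j) = \<mu> j)}"

text \<open>
  Costs and infima take values in \<^typ>\<open>ennreal\<close>, so no integrability or boundedness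
  side conditions are hidden in the definitions.
\<close>

definition MW2_squared :: "'a::euclidean_space measure \<Rightarrow> 'a measure \<Rightarrow> ennreal" where
  "MW2_squared \<mu> \<nu> =
     (INF \<gamma>\<in>couplings \<mu> \<nu> \<inter> GMM. \<integral>\<^sup>+ y. ennreal ((norm (fst y - snd y))\<^sup>2) \<partial>\<gamma>)"

definition bary :: "('j::finite \<Rightarrow> real) \<Rightarrow> 'a::euclidean_space ^ 'j \<Rightarrow> 'a" where
  "bary lam x = (\<Sum>i\<in>UNIV. lam i *\<^sub>R (x $ i))"

definition mm_cost :: "('j::finite \<Rightarrow> real) \<Rightarrow> 'a::euclidean_space ^ 'j \<Rightarrow> real" where
  "mm_cost lam x = (\<Sum>i\<in>UNIV. lam i * (norm (x $ i - bary lam x))\<^sup>2)"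

lemma mm_cost_pairwise:
  fixes x :: "'a::euclidean_space ^ 'j::finite"
  assumes "(\<Sum>i\<in>UNIV. lam i) = 1"
  shows "mm_cost lam x =
    (\<Sum>i\<in>UNIV. \<Sum>j\<in>UNIV. lam i * lam j * (norm (x $ i - x $ j))\<^sup>2) / 2"
proof -
  define b where "b = bary lam x"
  define Q where "Q = (\<Sum>i\<in>UNIV. lam i * (x $ i \<bullet> x $ i))"
  have lb: "(\<Sum>i\<in>UNIV. lam i * (x $ i \<bullet> y)) = b \<bullet> y" for y
    by (simp add: b_def bary_def inner_sum_left)
  have "mm_cost lam x =
      (\<Sum>i\<in>UNIV. lam i * (x $ i \<bullet> x $ i) - 2 * (lam i * (x $ i \<bullet> b)) + lam i * (b \<bullet> b))"
    unfolding mm_cost_def b_def[symmetric]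
    by (intro sum.cong) (auto simp: power2_norm_eq_inner inner_diff inner_commute algebra_simps)
  also have "\<dots> = Q - 2 * (b \<bullet> b) + b \<bullet> b"
    by (simp add: sum.distrib sum_subtractf lb Q_def assms
        flip: sum_distrib_left sum_distrib_right)
  finally have 1: "mm_cost lam x = Q - b \<bullet> b" by simp
  have "(\<Sum>j\<in>UNIV. lam i * lam j * (norm (x $ i - x $ j))\<^sup>2) =
      lam i * (x $ i \<bullet> x $ i) - 2 * (lam i * (x $ i \<bullet> b)) + lam i * Q" for i
  proof -
    have "(\<Sum>j\<in>UNIV. lam i * lam j * (norm (x $ i - x $ j))\<^sup>2) =
      (\<Sum>j\<in>UNIV. lam i * (x $ i \<bullet> x $ i) * lam j - 2 * lam i * (lam j * (x $ j \<bullet> x $ i))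
         + lam i * (lam j * (x $ j \<bullet> x $ j)))"
      by (intro sum.cong) (auto simp: power2_norm_eq_inner inner_diff inner_commute algebra_simps)
    also have "\<dots> = lam i * (x $ i \<bullet> x $ i) - 2 * lam i * (b \<bullet> x $ i) + lam i * Q"
      by (simp add: sum.distrib sum_subtractf lb Q_def assms flip: sum_distrib_left)
    finally show ?thesis by (simp add: inner_commute)
  qed
  then have "(\<Sum>i\<in>UNIV. \<Sum>j\<in>UNIV. lam i * lam j * (norm (x $ i - x $ j))\<^sup>2) =
      Q - 2 * (b \<bullet> b) + Q"
    by (simp add: sum.distrib sum_subtractf lb Q_def[symmetric] assms
        flip: sum_distrib_left sum_distrib_right)
  with 1 show ?thesis by simp
qed

definition mm_objective ::
    "('j::finite \<Rightarrow> real) \<Rightarrow> ('a::euclidean_space ^ 'j) measure \<Rightarrow> ennreal" where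
  "mm_objective lam \<gamma> = (\<integral>\<^sup>+ x. ennreal (mm_cost lam x) \<partial>\<gamma>)"

definition barycenter_objective ::
    "('j::finite \<Rightarrow> real) \<Rightarrow> ('j \<Rightarrow> 'a::euclidean_space measure) \<Rightarrow> 'a measure \<Rightarrow> ennreal" where
  "barycenter_objective lam \<mu> \<nu> = (\<Sum>j\<in>UNIV. ennreal (lam j) * MW2_squared (\<mu> j) \<nu>)"

end

theory Submission
  imports Defs "HOL-Real_Asymp.Real_Asymp"
begin

text \<open>
  Write \<open>C\<close> for the infimum of the multi-marginal problem over Gaussian mixture plans, and let
  \<open>\<gamma>\<close> be a minimizer. Pushing \<open>\<gamma>\<close> forward by \<open>x \<mapsto> (x\<^sub>j, B x)\<close> gives a Gaussian mixture
  coupling of \<open>\<mu>\<^sub>j\<close> and \<open>B#\<gamma>\<close>, and the weighted sum of the costs of these couplings is exactly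
  the integral of the multi-marginal cost; hence the barycenter objective at \<open>B#\<gamma>\<close> is at most \<open>C\<close>
  (\<open>barycenter_objective_bary_le\<close>). Conversely, let \<open>\<nu>\<close> be any Gaussian mixture and \<open>\<delta>\<^sub>j\<close> Gaussian
  mixture couplings of \<open>\<mu>\<^sub>j\<close> and \<open>\<nu>\<close>. Glue them along \<open>\<nu>\<close> to one Gaussian mixture in the variables
  \<open>(x, y)\<close>. Since the mean \<open>B x\<close> minimizes \<open>\<Sum> \<lambda>\<^sub>j |x\<^sub>j - y|\<^sup>2\<close> over \<open>y\<close>, this sum is at least \<open>c(x)\<close>,
  and integration shows that the total cost of the \<open>\<delta>\<^sub>j\<close> is at least \<open>C\<close>
  (\<open>mm_objective_le_barycenter_objective\<close>).

  Gluing two arbitrary couplings need not give a Gaussian mixture, so it is done on parameters. A finite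
  Gaussian mixture is encoded by a finitely supported distribution on pairs (mean, covariance), and
  this mixing distribution is determined by the mixture (\<open>gmix_inj\<close>): along a generic direction the
  exponential moments of distinct Gaussians are distinct functions \<open>exp (a r + b r\<^sup>2)\<close>, which are
  linearly independent. Therefore the \<open>y\<close>-marginals of the \<open>\<delta>\<^sub>j\<close> have the same mixing distribution,
  the mixing distributions can be glued as discrete laws (\<open>glue_pmf\<close>), and it remains to glue single
  Gaussians with a common \<open>y\<close>-marginal, which is done by regressing every \<open>x\<^sub>j\<close> on \<open>y\<close> and making the
  residuals independent (\<open>glue_gaussian_params\<close>).

  A minimizer exists because the problem is finite-dimensional. For a fixed tuple of Gaussian
  components, the joint covariances with the prescribed diagonal blocks form a compact set
  on which the cost is continuous (\<open>optimal_gaussian_param_coupling\<close>); replacing every component of a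
  plan by such an optimal one leaves a linear programme for the weights on the finitely many
  tuples of components, and its feasible set is compact (\<open>optimal_pmf_coupling\<close>).
\<close>

section \<open>Characteristic functions determine measures on Euclidean spaces\<close>

text \<open>
  Normalizing reduces this to the uniqueness theorem for distributions on the line. Finite
  measures, instead of probability measures, are what the weights of the next lemma produce.
\<close>

lemma finite_measure_eqI_char:
  fixes M N :: "real measure"
  assumes M: "finite_measure M" "sets M = sets borel" and N: "finite_measure N" "sets N = sets borel"
    and eq: "\<And>s. (CLINT x|M. iexp (s * x)) = (CLINT x|N. iexp (s * x))"
  shows "M = N"
proof -
  interpret M: finite_measure M by fact
  interpret N: finite_measure N by fact
  note [measurable_cong] = M(2) N(2)
  define c where "c = measure M (space M)"
  have cN: "c = measure N (space N)"
    using eq[of 0] by (simp add: c_def)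
  have emM: "emeasure M (space M) = ennreal c"
    by (simp add: c_def M.emeasure_eq_measure)
  have emN: "emeasure N (space N) = ennreal c"
    by (simp add: cN N.emeasure_eq_measure)
  show ?thesis
  proof (cases "c = 0")
    case True
    show ?thesis
    proof (rule measure_eqI)
      show "sets M = sets N" using M N by simp
      fix A
      have "emeasure M A \<le> emeasure M (space M)" "emeasure N A \<le> emeasure N (space N)"
        by (rule emeasure_space)+
      then show "emeasure M A = emeasure N A" using True emM emN by simp
    qed
  next
    case False
    then have c: "c > 0" by (simp add: c_def zero_less_measure_iff)
    define R where "R = (\<lambda>L :: real measure. density L (\<lambda>_. ennreal (1 / c)))"
    have rd: "real_distribution (R L)" if L: "sets L = sets borel" "emeasure L (space L) = ennreal c" for L
    proof -
      have "prob_space (R L)"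
        using c by (intro prob_spaceI)
          (simp add: R_def emeasure_density_const L(2) flip: ennreal_mult)
      then show ?thesis
        using L(1) by (simp add: real_distribution_def real_distribution_axioms_def R_def)
    qed
    have ch: "char (R L) s = (1 / c) *\<^sub>R (CLINT x|L. iexp (s * x))" if "sets L = sets borel" for L s
    proof -
      note [measurable_cong] = that
      have "char (R L) s = (CLINT x|L. (1 / c) *\<^sub>R iexp (s * x))"
        unfolding R_def char_def using c by (subst integral_density) auto
      also have "\<dots> = (1 / c) *\<^sub>R (CLINT x|L. iexp (s * x))" by (rule integral_scaleR_right)
      finally show ?thesis .
    qed
    have "R M = R N"
      using rd M N emM emN eq by (intro Levy_uniqueness) (auto simp: ch)
    have E: "emeasure L A = ennreal c * emeasure (R L) A" if "sets L = sets borel" "A \<in> sets borel" for L A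
    proof -
      have "ennreal c * (ennreal (1 / c) * emeasure L A) = emeasure L A"
        using c by (simp flip: mult.assoc ennreal_mult)
      then show ?thesis using that by (simp add: R_def emeasure_density nn_integral_cmult)
    qed
    show ?thesis
      using E[of M] E[of N] \<open>R M = R N\<close> M N by (intro measure_eqI) auto
  qed
qed

text \<open>
  The one-dimensional uniqueness theorem, applied to the image under
  \<open>x \<mapsto> x \<bullet> b\<close> of the measure with density \<open>g\<close>. It
  replaces the character in direction \<open>b\<close> by the indicator of a Borel set.
\<close>

lemma weighted_marginal_eqI_char:
  fixes M N :: "'a::euclidean_space measure" and g :: "'a \<Rightarrow> real"
  assumes M: "prob_space M" "sets M = sets borel" and N: "prob_space N" "sets N = sets borel"
    and g: "g \<in> borel_measurable borel" "\<And>x. 0 \<le> g x" "\<And>x. g x \<le> C"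
    and eq: "\<And>s. (CLINT x|M. g x *\<^sub>R iexp (s * (x \<bullet> b))) = (CLINT x|N. g x *\<^sub>R iexp (s * (x \<bullet> b)))"
    and A: "A \<in> sets borel"
  shows "(LINT x|M. g x * indicator A (x \<bullet> b)) = (LINT x|N. g x * indicator A (x \<bullet> b))"
proof -
  note [measurable] = g(1) A
  define P where "P = (\<lambda>L. distr (density L (\<lambda>x. ennreal (g x))) borel (\<lambda>x. x \<bullet> b))"
  have fin: "finite_measure (P L)" if "prob_space L" "sets L = sets borel" for L
  proof -
    interpret prob_space L by fact
    note [measurable_cong] = that(2)
    have "emeasure (P L) (space (P L)) = (\<integral>\<^sup>+x. ennreal (g x) \<partial>L)"
      by (simp add: P_def emeasure_distr emeasure_density cong: nn_integral_cong)
    also have "\<dots> \<le> (\<integral>\<^sup>+x. ennreal C \<partial>L)"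
      by (intro nn_integral_mono ennreal_leI g)
    also have "\<dots> < \<infinity>" by (simp add: emeasure_space_1)
    finally show ?thesis by (intro finite_measureI) auto
  qed
  have int: "(LINT y|P L. f y) = (LINT x|L. g x *\<^sub>R f (x \<bullet> b))" if "sets L = sets borel"
    "f \<in> borel_measurable borel" for L and f :: "real \<Rightarrow> 'z::{banach,second_countable_topology}"
  proof -
    note [measurable_cong] = that(1)
    note [measurable] = that(2)
    show ?thesis
      unfolding P_def by (subst integral_distr, measurable, subst integral_density) (auto simp: g)
  qed
  have "P M = P N"
    using M N fin eq by (intro finite_measure_eqI_char) (auto simp: int, simp_all add: P_def)
  have "(LINT y|P L. indicator A y) = (LINT x|L. g x * indicator A (x \<bullet> b))"
    if "sets L = sets borel" for L
    using int[OF that, of "indicator A :: real \<Rightarrow> real"] by simp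
  from this[OF M(2)] this[OF N(2)] show ?thesis unfolding \<open>P M = P N\<close> by simp
qed

text \<open>
  Coordinates are treated one at a time: if the integrals of
  \<open>\<Prod>b\<in>F. 1\<^bsub>A b\<^esub>(x \<bullet> b)\<close> times any character agree,
  the same holds with one more coordinate in \<open>F\<close>. After all coordinates the measures
  agree on boxes.
\<close>

lemma measure_eqI_char:
  fixes M N :: "'a::euclidean_space measure"
  assumes M: "prob_space M" "sets M = sets borel" and N: "prob_space N" "sets N = sets borel"
    and eq: "\<And>t. (CLINT x|M. iexp (t \<bullet> x)) = (CLINT x|N. iexp (t \<bullet> x))"
  shows "M = N"
proof -
  interpret M: prob_space M by fact
  interpret N: prob_space N by fact
  note [measurable_cong] = M(2) N(2)
  define I where "I = (\<lambda>A F (x::'a). \<Prod>b\<in>F. indicator (A b) (x \<bullet> b) :: real)"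
  have I01: "0 \<le> I A F x" "I A F x \<le> 1" for A F x
    by (auto simp: I_def intro!: prod_nonneg prod_le_1)
  have Im: "I A F \<in> borel_measurable borel" if "\<And>b. A b \<in> sets borel" for A F
  proof -
    note [measurable] = that
    show ?thesis unfolding I_def by measurable
  qed
  have intb: "integrable L f" if "prob_space L" "sets L = sets borel"
     "f \<in> borel_measurable borel" "\<And>x. norm (f x) \<le> C"
    for L :: "'a measure" and f :: "'a \<Rightarrow> 'z::{banach,second_countable_topology}" and C
  proof -
    interpret prob_space L by fact
    show ?thesis using that by (intro integrable_const_bound[where B=C]) auto
  qed
  have main: "(CLINT x|M. I A F x *\<^sub>R iexp (t \<bullet> x)) = (CLINT x|N. I A F x *\<^sub>R iexp (t \<bullet> x))"
    if A: "\<And>b. A b \<in> sets borel" and F: "finite F" for A F t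
    using F
  proof (induction F arbitrary: t)
    case empty
    then show ?case using eq by (simp add: I_def)
  next
    case (insert b F)
    note [measurable] = A Im[of A, OF A]
    \<comment> \<open>\<open>1 + h\<close> with \<open>h\<close> equal to \<open>0\<close>, \<open>cos (t \<bullet> x)\<close> or \<open>sin (t \<bullet> x)\<close> is a non-negative weight, and the
      character at \<open>t\<close> is a linear combination of these three weights.\<close>
    have step: "(LINT x|M. (I A F x * (1 + h x)) * indicator (A b) (x \<bullet> b)) =
        (LINT x|N. (I A F x * (1 + h x)) * indicator (A b) (x \<bullet> b))"
      if h: "\<And>x. \<bar>h x\<bar> \<le> 1" and
         hd: "\<And>x. complex_of_real (h x) = p * iexp (t \<bullet> x) + q * iexp ((- t) \<bullet> x)" and
         hm: "h \<in> borel_measurable borel" for h p q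
    proof (rule weighted_marginal_eqI_char[OF M N, where C=2])
      note [measurable] = hm
      show "(\<lambda>x. I A F x * (1 + h x)) \<in> borel_measurable borel" by measurable
      show "0 \<le> I A F x * (1 + h x)" for x
        using I01[of A F x] h[of x] by (auto intro!: mult_nonneg_nonneg)
      show "I A F x * (1 + h x) \<le> 2" for x
        using mult_mono[of "I A F x" 1 "1 + h x" 2] I01[of A F x] h[of x] by auto
      show "A b \<in> sets borel" by fact
      fix s
      have ex: "(CLINT x|L. (I A F x * (1 + h x)) *\<^sub>R iexp (s * (x \<bullet> b))) =
          (CLINT x|L. I A F x *\<^sub>R iexp ((s *\<^sub>R b) \<bullet> x)) +
          p * (CLINT x|L. I A F x *\<^sub>R iexp ((t + s *\<^sub>R b) \<bullet> x)) +
          q * (CLINT x|L. I A F x *\<^sub>R iexp ((- t + s *\<^sub>R b) \<bullet> x))"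
        if L: "prob_space L" "sets L = sets borel" for L
      proof -
        have int_iexp: "integrable L (\<lambda>x. I A F x *\<^sub>R iexp (u \<bullet> x))" for u
          using I01 by (intro intb[OF L, of _ 1]) (auto simp: norm_mult)
        have lin: "(CLINT x|L. e1 x + p * e2 x + q * e3 x) =
            (CLINT x|L. e1 x) + p * (CLINT x|L. e2 x) + q * (CLINT x|L. e3 x)"
          if "integrable L e1" "integrable L e2" "integrable L e3" for e1 e2 e3
          using that by simp
        have "(CLINT x|L. (I A F x * (1 + h x)) *\<^sub>R iexp (s * (x \<bullet> b))) =
          (CLINT x|L. I A F x *\<^sub>R iexp ((s *\<^sub>R b) \<bullet> x) +
          p * (I A F x *\<^sub>R iexp ((t + s *\<^sub>R b) \<bullet> x)) +
          q * (I A F x *\<^sub>R iexp ((- t + s *\<^sub>R b) \<bullet> x)))"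
        proof (rule Bochner_Integration.integral_cong[OF refl])
          fix x
          have "(I A F x * (1 + h x)) *\<^sub>R iexp (s * (x \<bullet> b)) =
             I A F x *\<^sub>R ((1 + complex_of_real (h x)) * iexp (s * (x \<bullet> b)))"
            by (simp add: scaleR_conv_of_real)
          also have "\<dots> = I A F x *\<^sub>R (iexp (s * (x \<bullet> b)) + p * (iexp (t \<bullet> x) * iexp (s * (x \<bullet> b)))
             + q * (iexp ((- t) \<bullet> x) * iexp (s * (x \<bullet> b))))"
            by (simp only: hd) (simp add: algebra_simps)
          also have "\<dots> = I A F x *\<^sub>R iexp ((s *\<^sub>R b) \<bullet> x) +
          p * (I A F x *\<^sub>R iexp ((t + s *\<^sub>R b) \<bullet> x)) +
          q * (I A F x *\<^sub>R iexp ((- t + s *\<^sub>R b) \<bullet> x))"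
            by (simp add: inner_left_distrib inner_commute distrib_left scaleR_right_distrib inner_diff_right
               inner_diff_left algebra_simps flip: exp_add)
          finally show "(I A F x * (1 + h x)) *\<^sub>R iexp (s * (x \<bullet> b)) = I A F x *\<^sub>R iexp ((s *\<^sub>R b) \<bullet> x) +
          p * (I A F x *\<^sub>R iexp ((t + s *\<^sub>R b) \<bullet> x)) +
          q * (I A F x *\<^sub>R iexp ((- t + s *\<^sub>R b) \<bullet> x))" .
        qed
        also have "\<dots> = (CLINT x|L. I A F x *\<^sub>R iexp ((s *\<^sub>R b) \<bullet> x)) +
          p * (CLINT x|L. I A F x *\<^sub>R iexp ((t + s *\<^sub>R b) \<bullet> x)) +
          q * (CLINT x|L. I A F x *\<^sub>R iexp ((- t + s *\<^sub>R b) \<bullet> x))"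
          by (rule lin) (rule int_iexp)+
        finally show ?thesis .
      qed
      show "(CLINT x|M. (I A F x * (1 + h x)) *\<^sub>R iexp (s * (x \<bullet> b))) =
         (CLINT x|N. (I A F x * (1 + h x)) *\<^sub>R iexp (s * (x \<bullet> b)))"
        unfolding ex[OF M] ex[OF N] insert.IH ..
    qed
    have 1: "(LINT x|M. I A F x * indicator (A b) (x \<bullet> b)) = (LINT x|N. I A F x * indicator (A b) (x \<bullet> b))"
      using step[of "\<lambda>_. 0" 0 0] by simp
    have 2: "(LINT x|M. (I A F x * (1 + cos (t \<bullet> x))) * indicator (A b) (x \<bullet> b)) =
        (LINT x|N. (I A F x * (1 + cos (t \<bullet> x))) * indicator (A b) (x \<bullet> b))"
      by (rule step[of _ "1/2" "1/2"])
        (auto simp: cos_exp_eq cos_of_real add_divide_distrib simp flip: cos_of_real)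
    have 3: "(LINT x|M. (I A F x * (1 + sin (t \<bullet> x))) * indicator (A b) (x \<bullet> b)) =
        (LINT x|N. (I A F x * (1 + sin (t \<bullet> x))) * indicator (A b) (x \<bullet> b))"
      by (rule step[of _ "1/(2*\<i>)" "-1/(2*\<i>)"])
        (auto simp: sin_exp_eq field_simps simp flip: sin_of_real)
    have split: "(LINT x|L. (I A F x * (1 + h x)) * indicator (A b) (x \<bullet> b)) =
        (LINT x|L. I A F x * indicator (A b) (x \<bullet> b)) + (LINT x|L. I A (insert b F) x * h x)"
      if L: "prob_space L" "sets L = sets borel" and h: "h \<in> borel_measurable borel" "\<And>x. \<bar>h x\<bar> \<le> 1"
      for L h
    proof -
      note [measurable] = h(1)
      have i1: "integrable L (\<lambda>x. I A F x * indicator (A b) (x \<bullet> b))"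
        using I01 by (intro intb[OF L, of _ 1]) (auto simp: indicator_def)
      have i2: "integrable L (\<lambda>x. I A (insert b F) x * h x)"
        using I01 h mult_mono[of "\<bar>I A (insert b F) _\<bar>" 1 "\<bar>h _\<bar>" 1]
        by (intro intb[OF L, of _ 1]) (auto simp: abs_mult)
      show ?thesis
        unfolding Bochner_Integration.integral_add[OF i1 i2, symmetric]
        by (intro Bochner_Integration.integral_cong)
          (simp_all add: I_def insert.hyps algebra_simps)
    qed
    have fin: "(CLINT x|L. I A (insert b F) x *\<^sub>R iexp (t \<bullet> x)) =
        complex_of_real (LINT x|L. I A (insert b F) x * cos (t \<bullet> x)) +
        \<i> * complex_of_real (LINT x|L. I A (insert b F) x * sin (t \<bullet> x))"
      if L: "prob_space L" "sets L = sets borel" for L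
    proof -
      have i: "integrable L (\<lambda>x. I A (insert b F) x * h x)"
        if h: "h \<in> borel_measurable borel" "\<And>x. \<bar>h x\<bar> \<le> 1" for h
        using I01 h mult_mono[of "\<bar>I A (insert b F) _\<bar>" 1 "\<bar>h _\<bar>" 1]
        by (intro intb[OF L, of _ 1]) (auto simp: abs_mult)
      have [simp]: "integrable L (\<lambda>x. I A (insert b F) x * cos (t \<bullet> x))"
         "integrable L (\<lambda>x. I A (insert b F) x * sin (t \<bullet> x))"
        by (auto intro!: i)
      have "(CLINT x|L. I A (insert b F) x *\<^sub>R iexp (t \<bullet> x)) =
        (CLINT x|L. complex_of_real (I A (insert b F) x * cos (t \<bullet> x)) +
        \<i> * complex_of_real (I A (insert b F) x * sin (t \<bullet> x)))"
        by (intro Bochner_Integration.integral_cong)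
          (auto simp: exp_Euler cos_of_real sin_of_real scaleR_conv_of_real algebra_simps)
      also have "\<dots> = complex_of_real (LINT x|L. I A (insert b F) x * cos (t \<bullet> x)) +
        \<i> * complex_of_real (LINT x|L. I A (insert b F) x * sin (t \<bullet> x))"
        by (subst Bochner_Integration.integral_add)
          (auto simp del: of_real_mult intro!: integrable_mult_right simp: integral_complex_of_real)
      finally show ?thesis .
    qed
    have "(LINT x|M. I A (insert b F) x * cos (t \<bullet> x)) = (LINT x|N. I A (insert b F) x * cos (t \<bullet> x))"
      using 2 1 by (simp add: split M N)
    moreover have "(LINT x|M. I A (insert b F) x * sin (t \<bullet> x)) = (LINT x|N. I A (insert b F) x * sin (t \<bullet> x))"
      using 3 1 by (simp add: split M N)
    ultimately show ?case by (simp add: fin M N)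
  qed
  have box_eq: "emeasure M (box l u) = emeasure N (box l u)" for l u
  proof -
    let ?A = "\<lambda>b. {l \<bullet> b <..< u \<bullet> b}"
    have ind: "I ?A Basis x = indicator (box l u) x" for x
      by (auto simp: I_def box_def indicator_def prod_zero_iff split: if_splits intro!: prod.neutral)
    have "(CLINT x|L. I ?A Basis x *\<^sub>R iexp (0 \<bullet> x)) = complex_of_real (measure L (box l u))"
      if "sets L = sets borel" for L :: "'a measure"
    proof -
      note [measurable_cong] = that
      have "(CLINT x|L. I ?A Basis x *\<^sub>R iexp (0 \<bullet> x)) = (CLINT x|L. complex_of_real (indicator (box l u) x))"
        by (simp add: ind scaleR_conv_of_real)
      also have "\<dots> = complex_of_real (LINT x|L. indicator (box l u) x)"
        by (rule integral_complex_of_real)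
      also have "\<dots> = complex_of_real (measure L (box l u))"
        using that sets_eq_imp_space_eq[OF that] by simp
      finally show ?thesis .
    qed
    then show ?thesis
      using main[of ?A Basis 0] M N by (simp add: M.emeasure_eq_measure N.emeasure_eq_measure)
  qed
  show ?thesis
  proof (rule measure_eqI_generator_eq[where E="range (\<lambda>(a, b). box a b)" and \<Omega>=UNIV
        and A="\<lambda>n. box (- (real n *\<^sub>R One)) (real n *\<^sub>R One)"])
    show "Int_stable (range (\<lambda>(a, b). box a b :: 'a set))"
      by (auto simp: Int_stable_def box_Int_box)
    show "sets M = sigma_sets UNIV (range (\<lambda>(a, b). box a b))" 
         "sets N = sigma_sets UNIV (range (\<lambda>(a, b). box a b))"
      unfolding M(2) N(2) by (subst borel_eq_box, simp)+
    show "(\<Union>i. box (- (real i *\<^sub>R One)) (real i *\<^sub>R One)) = (UNIV::'a set)"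
      by (rule UN_box_eq_UNIV)
  qed (auto simp: box_eq)
qed

section \<open>Degenerate Gaussian measures\<close>

lemma covariance_operatorD:
  assumes "covariance_operator S"
  shows "linear S" "S x \<bullet> y = x \<bullet> S y" "0 \<le> x \<bullet> S x"
  using assms by (auto simp: covariance_operator_def)

text \<open>
  A quadratic form that vanishes near a point has vanishing second differences there, hence
  vanishes identically; polarization does the rest.
\<close>

lemma symmetric_operator_zero_on_ball:
  assumes S: "linear S" "\<And>x y. S x \<bullet> y = x \<bullet> S y"
    and z: "e > 0" "\<And>x. x \<in> ball u e \<Longrightarrow> x \<bullet> S x = 0"
  shows "S x = 0"
proof -
  have diag: "v \<bullet> S v = 0" for v
  proof -
    \<comment> \<open>A step along \<open>v\<close> that stays in the ball; the summand \<open>1\<close> covers \<open>v = 0\<close>.\<close>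
    define r where "r = e / (2 * (norm v + 1))"
    have r: "r > 0" using z(1) by (simp add: r_def add_nonneg_pos)
    have "r * norm v \<le> r * (norm v + 1)" using r by simp
    also have "\<dots> = e / 2"
    proof -
      have "norm v + 1 \<noteq> 0" using norm_ge_zero[of v] by linarith
      then show ?thesis unfolding r_def by (simp add: divide_simps)
    qed
    finally have "r * norm v < e" using z(1) by simp
    then have in_ball: "u + r *\<^sub>R v \<in> ball u e" "u - r *\<^sub>R v \<in> ball u e" "u \<in> ball u e"
      using r z(1) by (auto simp: dist_norm)
    have "(u + r *\<^sub>R v) \<bullet> S (u + r *\<^sub>R v) + (u - r *\<^sub>R v) \<bullet> S (u - r *\<^sub>R v) =
        2 * (u \<bullet> S u) + 2 * r\<^sup>2 * (v \<bullet> S v)"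
      by (simp add: linear_add[OF S(1)] linear_diff[OF S(1)] linear_scale[OF S(1)] inner_simps
          power2_eq_square algebra_simps)
    then show ?thesis using z(2)[OF in_ball(1)] z(2)[OF in_ball(2)] z(2)[OF in_ball(3)] r by simp
  qed
  have "x \<bullet> S y = 0" for x y
  proof -
    have "(x + y) \<bullet> S (x + y) = x \<bullet> S x + y \<bullet> S y + 2 * (x \<bullet> S y)"
      using S(2)[of y x] by (simp add: linear_add[OF S(1)] inner_simps inner_commute)
    then show ?thesis by (simp add: diag)
  qed
  from this[of "S x" x] show ?thesis by simp
qed

lemma covariance_operator_eqI:
  assumes S: "covariance_operator S" and T: "covariance_operator T"
    and eq: "\<And>x. x \<bullet> S x = x \<bullet> T x"
  shows "S = T"
proof
  fix x
  have "S x - T x = 0"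
  proof (rule symmetric_operator_zero_on_ball[where S="\<lambda>x. S x - T x" and e=1 and u=0])
    show "linear (\<lambda>x. S x - T x)"
      using S T by (intro linear_compose_sub) (auto dest: covariance_operatorD)
    show "(S x - T x) \<bullet> y = x \<bullet> (S y - T y)" for x y
      by (simp add: inner_diff covariance_operatorD(2)[OF S] covariance_operatorD(2)[OF T])
  qed (simp_all add: inner_diff eq)
  then show "S x = T x" by simp
qed

lemma covariance_operator_Cauchy_Schwarz:
  assumes "covariance_operator S"
  shows "(x \<bullet> S y)\<^sup>2 \<le> (x \<bullet> S x) * (y \<bullet> S y)"
proof -
  note S = covariance_operatorD[OF assms]
  have q: "0 \<le> x \<bullet> S x + 2 * r * (x \<bullet> S y) + r\<^sup>2 * (y \<bullet> S y)" for r
  proof -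
    have "(x + r *\<^sub>R y) \<bullet> S (x + r *\<^sub>R y) = x \<bullet> S x + 2 * r * (x \<bullet> S y) + r\<^sup>2 * (y \<bullet> S y)"
      using S(2)[of y x] by (simp add: linear_add[OF S(1)] linear_scale[OF S(1)] inner_simps
          power2_eq_square inner_commute algebra_simps)
    with S(3)[of "x + r *\<^sub>R y"] show ?thesis by simp
  qed
  show ?thesis
  proof (cases "y \<bullet> S y = 0")
    case True
    have "x \<bullet> S y = 0"
    proof (rule ccontr)
      assume "x \<bullet> S y \<noteq> 0"
      then show False
        using q[of "- (x \<bullet> S x + 1) / (2 * (x \<bullet> S y))"] True by (simp add: field_simps)
    qed
    then show ?thesis using True by simp
  next
    case False
    then have p: "y \<bullet> S y > 0" using S(3)[of y] by simp
    have "0 \<le> (y \<bullet> S y) * (x \<bullet> S x + 2 * (- (x \<bullet> S y) / (y \<bullet> S y)) * (x \<bullet> S y) + (- (x \<bullet> S y) / (y \<bullet> S y))\<^sup>2 * (y \<bullet> S y))"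
      using q[of "- (x \<bullet> S y) / (y \<bullet> S y)"] p by (intro mult_nonneg_nonneg) auto
    also have "\<dots> = (x \<bullet> S x) * (y \<bullet> S y) - (x \<bullet> S y)\<^sup>2"
      using p by (simp add: field_simps power2_eq_square)
    finally show ?thesis by simp
  qed
qed

text \<open>
  By Cauchy--Schwarz, a direction of zero variance is uncorrelated with everything.
\<close>

lemma covariance_operator_kernel:
  assumes S: "covariance_operator S" and x: "x \<bullet> S x = 0"
  shows "S x = 0"
  using covariance_operator_Cauchy_Schwarz[OF S, of "S x" x] x by simp

lemma covariance_operator_pushforward:
  fixes L :: "'a::euclidean_space \<Rightarrow> 'b::euclidean_space"
  assumes L: "linear L" and S: "covariance_operator S"
  shows "covariance_operator (\<lambda>u. L (S (adjoint L u)))"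
  unfolding covariance_operator_def
proof (intro conjI allI)
  note S = covariance_operatorD[OF S] and A = adjoint_works[OF L] adjoint_clauses(2)[OF L]
  show "linear (\<lambda>u. L (S (adjoint L u)))"
    using linear_compose[OF linear_compose[OF adjoint_linear[OF L] S(1)] L] by (simp add: o_def)
  show "L (S (adjoint L x)) \<bullet> y = x \<bullet> L (S (adjoint L y))" for x y
    by (metis A S(2) inner_commute)
  show "0 \<le> x \<bullet> L (S (adjoint L x))" for x
    by (metis A(1) S(3) inner_commute)
qed

lemma borel_measurable_linear:
  fixes L :: "'a::euclidean_space \<Rightarrow> 'b::euclidean_space"
  assumes "linear L"
  shows "L \<in> borel_measurable borel"
  using assms by (intro borel_measurable_continuous_onI linear_continuous_on)
    (simp add: linear_conv_bounded_linear)

lemma gaussian_distr_linear: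
  fixes L :: "'a::euclidean_space \<Rightarrow> 'b::euclidean_space"
  assumes L: "linear L" and M: "gaussian m S M"
  shows "gaussian (L m) (\<lambda>u. L (S (adjoint L u))) (distr M borel L)"
proof -
  note [measurable] = borel_measurable_linear[OF L]
  from M have S: "covariance_operator S" and p: "prob_space M" and s[measurable_cong]: "sets M = sets borel"
    and c: "\<And>t. (CLINT x|M. iexp (t \<bullet> x)) =
          exp (\<i> * complex_of_real (t \<bullet> m) - complex_of_real (t \<bullet> S t) / 2)"
    by (auto simp: gaussian_def)
  have A: "u \<bullet> L x = adjoint L u \<bullet> x" for u x
    by (simp add: adjoint_works[OF L] inner_commute)
  have "(CLINT x|distr M borel L. iexp (t \<bullet> x)) = (CLINT x|M. iexp (adjoint L t \<bullet> x))" for t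
    by (subst integral_distr) (auto simp: A)
  then show ?thesis
    using covariance_operator_pushforward[OF L S] prob_space.prob_space_distr[OF p, of L borel]
    by (auto simp: gaussian_def c A measurable_cong_sets[OF s refl])
qed

text \<open>
  The law of \<open>X + Z v\<close> with \<open>X\<close> distributed as \<open>M\<close> and
  \<open>Z\<close> an independent standard normal variable.
\<close>

lemma gaussian_convolve_normal:
  fixes m v :: "'a::euclidean_space"
  assumes M: "gaussian m S M"
  shows "\<exists>M'. gaussian m (\<lambda>x. S x + (v \<bullet> x) *\<^sub>R v) M'"
proof -
  let ?Z = std_normal_distribution
  interpret Z: prob_space ?Z by (rule prob_space_normal_density) simp
  from M have S: "covariance_operator S" and p: "prob_space M" and s[measurable_cong]: "sets M = sets borel"
    and c: "\<And>t. (CLINT x|M. iexp (t \<bullet> x)) =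
          exp (\<i> * complex_of_real (t \<bullet> m) - complex_of_real (t \<bullet> S t) / 2)"
    by (auto simp: gaussian_def)
  interpret M: prob_space M by fact
  interpret P: pair_prob_space M ?Z ..
  let ?f = "\<lambda>(x, z). x + z *\<^sub>R v"
  have f[measurable]: "?f \<in> borel_measurable (M \<Otimes>\<^sub>M ?Z)" by measurable
  have "(CLINT x|distr (M \<Otimes>\<^sub>M ?Z) borel ?f. iexp (t \<bullet> x)) =
     exp (\<i> * complex_of_real (t \<bullet> m) - complex_of_real (t \<bullet> (S t + (v \<bullet> t) *\<^sub>R v)) / 2)" for t
  proof -
    have "(CLINT x|distr (M \<Otimes>\<^sub>M ?Z) borel ?f. iexp (t \<bullet> x)) =
       (CLINT w|M \<Otimes>\<^sub>M ?Z. iexp (t \<bullet> fst w) * iexp ((t \<bullet> v) * snd w))"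
      by (subst integral_distr) (auto intro!: Bochner_Integration.integral_cong simp: inner_simps
          algebra_simps simp flip: exp_add)
    also have "\<dots> = (CLINT x|M. CLINT z|?Z. iexp (t \<bullet> x) * iexp ((t \<bullet> v) * z))"
      by (subst P.integral_fst'[symmetric])
        (auto intro!: P.integrable_const_bound[where B=1] simp: norm_mult)
    also have "\<dots> = (CLINT x|M. iexp (t \<bullet> x) * char ?Z (t \<bullet> v))"
      by (simp add: char_def)
    also have "\<dots> = exp (\<i> * complex_of_real (t \<bullet> m) - complex_of_real (t \<bullet> S t) / 2) * char ?Z (t \<bullet> v)"
      by (simp add: c)
    also have "\<dots> = exp (\<i> * complex_of_real (t \<bullet> m) - complex_of_real (t \<bullet> S t) / 2) *
        exp (complex_of_real (- ((t \<bullet> v)\<^sup>2) / 2))"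
      by (simp only: char_std_normal_distribution exp_of_real)
    also have "\<dots> = exp (\<i> * complex_of_real (t \<bullet> m) - complex_of_real (t \<bullet> (S t + (v \<bullet> t) *\<^sub>R v)) / 2)"
      by (simp add: power2_eq_square inner_simps inner_commute add_divide_distrib diff_divide_distrib algebra_simps flip: exp_add)
    finally show ?thesis .
  qed
  moreover have "covariance_operator (\<lambda>x. S x + (v \<bullet> x) *\<^sub>R v)"
    unfolding covariance_operator_def
  proof (intro conjI allI)
    note S = covariance_operatorD[OF S]
    show "linear (\<lambda>x. S x + (v \<bullet> x) *\<^sub>R v)"
      by (rule linearI) (simp_all add: linear_add[OF S(1)] linear_scale[OF S(1)] inner_simps algebra_simps)
    show "(S x + (v \<bullet> x) *\<^sub>R v) \<bullet> y = x \<bullet> (S y + (v \<bullet> y) *\<^sub>R v)" for x y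
      using S(2)[of x y] by (simp add: inner_simps inner_commute)
    show "0 \<le> x \<bullet> (S x + (v \<bullet> x) *\<^sub>R v)" for x
      using S(3)[of x] by (simp add: inner_simps inner_commute)
  qed
  ultimately have "gaussian m (\<lambda>x. S x + (v \<bullet> x) *\<^sub>R v) (distr (M \<Otimes>\<^sub>M ?Z) borel ?f)"
    using P.prob_space_distr[OF f] by (simp add: gaussian_def)
  then show ?thesis by blast
qed

text \<open>
  A Cholesky-type induction on the rank: if \<open>S\<close> is not zero, a rank-one operator
  \<open>v v\<^sup>T\<close> can be subtracted so that \<open>S - v v\<^sup>T\<close> stays
  positive semi-definite and has a larger kernel. Adding \<open>v v\<^sup>T\<close> back is a
  convolution with a normal variable along \<open>v\<close>.
\<close>

lemma gaussian_exists:
  fixes m :: "'a::euclidean_space"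
  assumes "covariance_operator S"
  shows "\<exists>M. gaussian m S M"
  using assms
proof (induction "DIM('a) - dim {x. S x = 0}" arbitrary: S rule: less_induct)
  case less
  note S = covariance_operatorD[OF less.prems]
  show ?case
  proof (cases "\<exists>x. x \<bullet> S x \<noteq> 0")
    case False
    then have "S = (\<lambda>_. 0)"
      using covariance_operator_kernel[OF less.prems] by blast
    then show ?thesis using gaussian_return by blast
  next
    case True
    then obtain x where "x \<bullet> S x \<noteq> 0" by blast
    then have x: "x \<bullet> S x > 0" using S(3)[of x] by simp
    \<comment> \<open>The scaling makes \<open>x\<close> a new kernel element: \<open>(v \<bullet> x) *\<^sub>R v = S x\<close>.\<close>
    define v where "v = (1 / sqrt (x \<bullet> S x)) *\<^sub>R S x"
    define T where "T = (\<lambda>y. S y - (v \<bullet> y) *\<^sub>R v)"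
    have vv: "(v \<bullet> y) * (v \<bullet> z) = (S x \<bullet> y) * (S x \<bullet> z) / (x \<bullet> S x)" for y z
      using x by (simp add: v_def field_simps flip: power2_eq_square)
    have T: "covariance_operator T"
      unfolding covariance_operator_def
    proof (intro conjI allI)
      show "linear T" unfolding T_def
        by (rule linearI) (simp_all add: linear_add[OF S(1)] linear_scale[OF S(1)] inner_simps algebra_simps)
      show "T y \<bullet> z = y \<bullet> T z" for y z
        using S(2)[of y z] by (simp add: T_def inner_simps inner_commute)
      show "0 \<le> y \<bullet> T y" for y
      proof -
        have "y \<bullet> T y = y \<bullet> S y - (S x \<bullet> y) * (S x \<bullet> y) / (x \<bullet> S x)"
          using vv[of y y] by (simp add: T_def inner_simps inner_commute)
        moreover have "(S x \<bullet> y) * (S x \<bullet> y) \<le> (y \<bullet> S y) * (x \<bullet> S x)"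
          using covariance_operator_Cauchy_Schwarz[OF less.prems, of y x]
          by (simp add: power2_eq_square inner_commute)
        ultimately show ?thesis using x by (simp add: divide_le_eq)
      qed
    qed
    have Tx: "T x = 0"
    proof -
      have "(v \<bullet> x) *\<^sub>R v = S x"
        using x by (simp add: v_def inner_commute flip: power2_eq_square)
      then show ?thesis by (simp add: T_def)
    qed
    have sub: "{y. S y = 0} \<subset> {y. T y = 0}"
    proof
      show "{y. S y = 0} \<subseteq> {y. T y = 0}"
        using S(2)[of x] by (auto simp: T_def v_def)
      show "{y. S y = 0} \<noteq> {y. T y = 0}"
      proof
        assume "{y. S y = 0} = {y. T y = 0}"
        then have "S x = 0" using Tx by blast
        then show False using x by simp
      qed
    qed
    have ss: "subspace {y. S y = 0}" "subspace {y. T y = 0}"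
      using S(1) covariance_operatorD(1)[OF T] by (auto intro: linear_subspace_kernel)
    then have "span {y. S y = 0} \<subset> span {y. T y = 0}"
      using sub by (simp add: span_eq_iff[THEN iffD2])
    then have "dim {y. S y = 0} < dim {y. T y = 0}" by (rule dim_psubset)
    moreover have "dim {y. T y = 0} \<le> DIM('a)" by (rule dim_subset_UNIV)
    ultimately have "DIM('a) - dim {y. T y = 0} < DIM('a) - dim {y. S y = 0}" by simp
    from less.hyps[OF this T] obtain M where "gaussian m T M" by blast
    from gaussian_convolve_normal[OF this, of v] show ?thesis by (simp add: T_def)
  qed
qed

section \<open>Finite mixtures as distributions on Gaussian parameters\<close>

definition gaussian_params :: "('a::euclidean_space \<times> ('a \<Rightarrow> 'a)) set" where
  "gaussian_params = {p. covariance_operator (snd p)}"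

text \<open>
  Outside \<open>gaussian_params\<close> the value is a point mass only so that \<open>gauss_law\<close>
  is a probability kernel on all pairs.
\<close>

definition gauss_law :: "'a::euclidean_space \<times> ('a \<Rightarrow> 'a) \<Rightarrow> 'a measure" where
  "gauss_law p = (if p \<in> gaussian_params then SOME M. gaussian (fst p) (snd p) M else return borel 0)"

lemma gaussian_gauss_law: "p \<in> gaussian_params \<Longrightarrow> gaussian (fst p) (snd p) (gauss_law p)"
  using gaussian_exists[of "snd p" "fst p"]
  by (auto simp: gaussian_params_def gauss_law_def intro: someI_ex)

lemma gaussian_unique: "gaussian m S M \<Longrightarrow> gaussian m S N \<Longrightarrow> M = N"
  by (rule measure_eqI_char) (auto simp: gaussian_def)

lemma gaussian_eq_gauss_law: "gaussian m S M \<Longrightarrow> M = gauss_law (m, S)"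
  using gaussian_gauss_law[of "(m, S)"]
  by (auto intro: gaussian_unique simp: gaussian_params_def gaussian_def)

lemma prob_space_gauss_law: "prob_space (gauss_law p)"
  using gaussian_gauss_law[of p]
  by (cases "p \<in> gaussian_params") (auto simp: gaussian_def gauss_law_def intro!: prob_space_return)

lemma sets_gauss_law[simp, measurable_cong]: "sets (gauss_law p) = sets borel"
  using gaussian_gauss_law[of p]
  by (cases "p \<in> gaussian_params") (auto simp: gaussian_def gauss_law_def)

text \<open>
  The parameters of the image of a Gaussian law under a linear map \<open>L\<close>: mean
  \<open>L m\<close> and covariance \<open>L S L\<^sup>T\<close>.
\<close>

definition push_param :: "('a::euclidean_space \<Rightarrow> 'b::euclidean_space) \<Rightarrow> 'a \<times> ('a \<Rightarrow> 'a) \<Rightarrow> 'b \<times> ('b \<Rightarrow> 'b)" where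
  "push_param L p = (L (fst p), \<lambda>u. L (snd p (adjoint L u)))"

lemma push_param_in_gaussian_params: "linear L \<Longrightarrow> p \<in> gaussian_params \<Longrightarrow> push_param L p \<in> gaussian_params"
  by (simp add: gaussian_params_def push_param_def covariance_operator_pushforward)

lemma push_param_compose:
  assumes "linear L" "linear K"
  shows "push_param K (push_param L p) = push_param (\<lambda>x. K (L x)) p"
proof -
  have "adjoint (\<lambda>x. K (L x)) = (\<lambda>u. adjoint L (adjoint K u))"
    using assms by (intro adjoint_unique) (simp add: adjoint_works)
  then show ?thesis by (simp add: push_param_def)
qed

lemma distr_gauss_law:
  assumes "linear L" "p \<in> gaussian_params"
  shows "distr (gauss_law p) borel L = gauss_law (push_param L p)"
  using gaussian_eq_gauss_law[OF gaussian_distr_linear[OF assms(1) gaussian_gauss_law[OF assms(2)]]]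
  by (simp add: push_param_def)

text \<open>
  One-dimensional marginals are affine images of the standard normal law, also in the degenerate
  case, where the factor is zero. All moments of Gaussian laws below are computed from this.
\<close>

lemma distr_gauss_law_inner:
  assumes p: "p \<in> gaussian_params"
  shows "distr (gauss_law p) borel (\<lambda>x. u \<bullet> x) =
     distr std_normal_distribution borel (\<lambda>z. u \<bullet> fst p + sqrt (u \<bullet> snd p u) * z)"
proof -
  let ?Z = std_normal_distribution
  interpret Z: prob_space ?Z by (rule prob_space_normal_density) simp
  interpret N: prob_space "gauss_law p" by (rule prob_space_gauss_law)
  have s: "0 \<le> u \<bullet> snd p u" using p by (simp add: gaussian_params_def covariance_operatorD)
  have "gaussian (0::real) (\<lambda>x. 1\<^sup>2 * x) ?Z" by (rule gaussian_normal_density) simp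
  then have c: "(CLINT x|?Z. iexp (t * x)) = exp (- complex_of_real (t * t) / 2)" for t
    by (simp add: gaussian_def)
  show ?thesis
  proof (rule measure_eqI_char)
    show "prob_space (distr (gauss_law p) borel ((\<bullet>) u))"
      by (rule N.prob_space_distr) simp
    show "prob_space (distr ?Z borel (\<lambda>z. u \<bullet> fst p + sqrt (u \<bullet> snd p u) * z))"
      by (rule Z.prob_space_distr) simp
    fix t :: real
    have "(CLINT x|distr (gauss_law p) borel (\<lambda>x. u \<bullet> x). iexp (t \<bullet> x)) =
      (CLINT x|gauss_law p. iexp ((t *\<^sub>R u) \<bullet> x))"
      by (subst integral_distr) auto
    also have "\<dots> = exp (\<i> * complex_of_real ((t *\<^sub>R u) \<bullet> fst p)
        - complex_of_real ((t *\<^sub>R u) \<bullet> snd p (t *\<^sub>R u)) / 2)"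
      using gaussian_gauss_law[OF p] by (simp only: gaussian_def)
    also have "(t *\<^sub>R u) \<bullet> snd p (t *\<^sub>R u) = (t * sqrt (u \<bullet> snd p u)) * (t * sqrt (u \<bullet> snd p u))"
      using p s by (simp add: gaussian_params_def linear_scale[OF covariance_operatorD(1)])
    also have "exp (\<i> * complex_of_real ((t *\<^sub>R u) \<bullet> fst p) -
         complex_of_real ((t * sqrt (u \<bullet> snd p u)) * (t * sqrt (u \<bullet> snd p u))) / 2) =
       iexp (t * (u \<bullet> fst p)) * (CLINT z|?Z. iexp ((t * sqrt (u \<bullet> snd p u)) * z))"
      unfolding c by (simp flip: exp_add)
    also have "\<dots> = (CLINT z|?Z. iexp (t * (u \<bullet> fst p + sqrt (u \<bullet> snd p u) * z)))"
      by (subst integral_mult_right_zero[symmetric])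
         (auto intro!: Bochner_Integration.integral_cong simp: algebra_simps simp flip: exp_add)
    also have "\<dots> = (CLINT z|distr ?Z borel (\<lambda>z. u \<bullet> fst p + sqrt (u \<bullet> snd p u) * z). iexp (t \<bullet> z))"
      by (subst integral_distr) auto
    finally show "(CLINT x|distr (gauss_law p) borel (\<lambda>x. u \<bullet> x). iexp (t \<bullet> x)) =
      (CLINT z|distr ?Z borel (\<lambda>z. u \<bullet> fst p + sqrt (u \<bullet> snd p u) * z). iexp (t \<bullet> z))" .
  qed auto
qed

lemma nn_integral_gauss_law_inner:
  assumes p: "p \<in> gaussian_params" and f[measurable]: "f \<in> borel_measurable borel"
  shows "(\<integral>\<^sup>+x. f (u \<bullet> x) \<partial>gauss_law p) =
    (\<integral>\<^sup>+z. ennreal (std_normal_density z) * f (u \<bullet> fst p + sqrt (u \<bullet> snd p u) * z) \<partial>lborel)"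
proof -
  have "(\<integral>\<^sup>+x. f (u \<bullet> x) \<partial>gauss_law p) = (\<integral>\<^sup>+y. f y \<partial>distr (gauss_law p) borel (\<lambda>x. u \<bullet> x))"
    by (subst nn_integral_distr) auto
  also have "\<dots> = (\<integral>\<^sup>+z. f (u \<bullet> fst p + sqrt (u \<bullet> snd p u) * z) \<partial>std_normal_distribution)"
    unfolding distr_gauss_law_inner[OF p] by (subst nn_integral_distr) auto
  also have "\<dots> = (\<integral>\<^sup>+z. ennreal (std_normal_density z) * f (u \<bullet> fst p + sqrt (u \<bullet> snd p u) * z) \<partial>lborel)"
    by (subst nn_integral_density) auto
  finally show ?thesis .
qed

text \<open>
  Completing the square.
\<close>

lemma gauss_law_exponential_moment:
  assumes p: "p \<in> gaussian_params"
  shows "(\<integral>\<^sup>+x. ennreal (exp (u \<bullet> x)) \<partial>gauss_law p) = ennreal (exp (u \<bullet> fst p + (u \<bullet> snd p u) / 2))"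
proof -
  define s where "s = sqrt (u \<bullet> snd p u)"
  have s2: "s\<^sup>2 = u \<bullet> snd p u" using p by (simp add: s_def gaussian_params_def covariance_operatorD)
  interpret Z: prob_space "density lborel (normal_density s 1)" by (rule prob_space_normal_density) simp
  have one: "(\<integral>\<^sup>+z. ennreal (normal_density s 1 z) \<partial>lborel) = 1"
    using Z.emeasure_space_1 by (simp add: emeasure_density)
  have "(\<integral>\<^sup>+x. ennreal (exp (u \<bullet> x)) \<partial>gauss_law p) =
      (\<integral>\<^sup>+z. ennreal (std_normal_density z) * ennreal (exp (u \<bullet> fst p + s * z)) \<partial>lborel)"
    unfolding s_def by (rule nn_integral_gauss_law_inner[OF p, of "\<lambda>y. ennreal (exp y)"]) simp
  also have "\<dots> = (\<integral>\<^sup>+z. ennreal (exp (u \<bullet> fst p + s\<^sup>2 / 2)) * ennreal (normal_density s 1 z) \<partial>lborel)"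
  proof (intro nn_integral_cong)
    fix z
    have "exp (- z\<^sup>2 / 2) * exp (u \<bullet> fst p + s * z) =
       exp (u \<bullet> fst p + s\<^sup>2 / 2) * exp (- (z - s)\<^sup>2 / 2)"
      by (simp add: power2_eq_square field_simps flip: exp_add)
    then have "std_normal_density z * exp (u \<bullet> fst p + s * z) =
       exp (u \<bullet> fst p + s\<^sup>2 / 2) * normal_density s 1 z"
      by (simp add: normal_density_def)
    then show "ennreal (std_normal_density z) * ennreal (exp (u \<bullet> fst p + s * z)) =
       ennreal (exp (u \<bullet> fst p + s\<^sup>2 / 2)) * ennreal (normal_density s 1 z)"
      by (simp flip: ennreal_mult')
  qed
  also have "\<dots> = ennreal (exp (u \<bullet> fst p + s\<^sup>2 / 2))"
    by (subst nn_integral_cmult) (auto simp: one)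
  finally show ?thesis by (simp add: s2)
qed

lemma gauss_law_second_moment:
  assumes p: "p \<in> gaussian_params"
  shows "(\<integral>\<^sup>+x. ennreal ((u \<bullet> x)\<^sup>2) \<partial>gauss_law p) = ennreal ((u \<bullet> fst p)\<^sup>2 + u \<bullet> snd p u)"
proof -
  define s where "s = sqrt (u \<bullet> snd p u)"
  define a where "a = u \<bullet> fst p"
  have s2: "s\<^sup>2 = u \<bullet> snd p u" using p by (simp add: s_def gaussian_params_def covariance_operatorD)
  have "has_bochner_integral lborel (\<lambda>z. a\<^sup>2 * std_normal_density z + 2 * a * s * (std_normal_density z * z)
      + s\<^sup>2 * (std_normal_density z * z\<^sup>2)) (a\<^sup>2 * 1 + 2 * a * s * 0 + s\<^sup>2 * 1)"
  proof (intro has_bochner_integral_add has_bochner_integral_mult_right)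
    show "has_bochner_integral lborel std_normal_density 1"
      using std_normal_moment_even[of 0] by simp
    show "has_bochner_integral lborel (\<lambda>z. std_normal_density z * z) 0"
      using std_normal_moment_odd[of 0] by simp
    show "has_bochner_integral lborel (\<lambda>z. std_normal_density z * z\<^sup>2) 1"
      using std_normal_moment_even[of 1] by (simp add: fact_numeral)
  qed
  moreover have "(\<lambda>z. a\<^sup>2 * std_normal_density z + 2 * a * s * (std_normal_density z * z)
      + s\<^sup>2 * (std_normal_density z * z\<^sup>2)) = (\<lambda>z. std_normal_density z * (a + s * z)\<^sup>2)"
    by (simp add: fun_eq_iff power2_eq_square algebra_simps)
  ultimately have "has_bochner_integral lborel (\<lambda>z. std_normal_density z * (a + s * z)\<^sup>2) (a\<^sup>2 + s\<^sup>2)"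
    by simp
  then have "(\<integral>\<^sup>+z. ennreal (std_normal_density z * (a + s * z)\<^sup>2) \<partial>lborel) = ennreal (a\<^sup>2 + s\<^sup>2)"
    by (subst nn_integral_eq_integral) (auto simp: has_bochner_integral_iff)
  moreover have "(\<integral>\<^sup>+x. ennreal ((u \<bullet> x)\<^sup>2) \<partial>gauss_law p) =
      (\<integral>\<^sup>+z. ennreal (std_normal_density z) * ennreal ((a + s * z)\<^sup>2) \<partial>lborel)"
    unfolding s_def a_def by (rule nn_integral_gauss_law_inner[OF p, of "\<lambda>y. ennreal (y\<^sup>2)"]) simp
  ultimately show ?thesis by (simp add: s2 a_def ennreal_mult)
qed

text \<open>
  The mixture with mixing distribution \<open>W\<close>. Since \<open>W\<close> lives on
  parameters, components with equal parameters are merged automatically, without which the mixing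
  distribution of a mixture could not be unique.
\<close>

definition gmix :: "('a::euclidean_space \<times> ('a \<Rightarrow> 'a)) pmf \<Rightarrow> 'a measure" where
  "gmix W = measure_pmf W \<bind> gauss_law"

lemma gauss_law_kernel: "gauss_law \<in> measurable (measure_pmf W) (subprob_algebra borel)"
  by (auto simp: measurable_def space_subprob_algebra prob_space_gauss_law prob_space_imp_subprob_space)

lemma sets_gmix[simp, measurable_cong]: "sets (gmix W) = sets borel"
  unfolding gmix_def by (rule sets_bind) auto

lemma nn_integral_gmix:
  "f \<in> borel_measurable borel \<Longrightarrow>
    (\<integral>\<^sup>+x. f x \<partial>gmix W) = (\<integral>\<^sup>+p. \<integral>\<^sup>+x. f x \<partial>gauss_law p \<partial>measure_pmf W)"
  unfolding gmix_def by (rule nn_integral_bind[OF _ gauss_law_kernel])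

lemma emeasure_gmix:
  "A \<in> sets borel \<Longrightarrow> emeasure (gmix W) A = (\<integral>\<^sup>+p. emeasure (gauss_law p) A \<partial>measure_pmf W)"
  unfolding gmix_def by (rule emeasure_bind[OF _ gauss_law_kernel]) simp_all

lemma prob_space_gmix: "prob_space (gmix W)"
proof
  have "emeasure (gauss_law p) UNIV = 1" for p :: "'a \<times> ('a \<Rightarrow> 'a)"
    using prob_space.emeasure_space_1[OF prob_space_gauss_law[of p]]
      sets_eq_imp_space_eq[OF sets_gauss_law[of p]] by simp
  then show "emeasure (gmix W) (space (gmix W)) = 1"
    using sets_eq_imp_space_eq[OF sets_gmix[of W]]
    by (simp add: emeasure_gmix measure_pmf.emeasure_space_1[simplified])
qed

lemma distr_gmix:
  fixes L :: "'a::euclidean_space \<Rightarrow> 'b::euclidean_space"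
  assumes L: "linear L" and W: "set_pmf W \<subseteq> gaussian_params"
  shows "distr (gmix W) borel L = gmix (map_pmf (push_param L) W)"
proof (rule measure_eqI)
  fix A assume "A \<in> sets (distr (gmix W) borel L)"
  then have [measurable]: "A \<in> sets borel" by simp
  note [measurable] = borel_measurable_linear[OF L]
  have v: "L -` A \<in> sets borel" using measurable_sets_borel[OF borel_measurable_linear[OF L], of A] by simp
  have "emeasure (distr (gmix W) borel L) A = (\<integral>\<^sup>+p. emeasure (gauss_law p) (L -` A) \<partial>measure_pmf W)"
    using v sets_eq_imp_space_eq[OF sets_gmix[of W]] by (subst emeasure_distr) (auto simp: emeasure_gmix)
  also have "\<dots> = (\<integral>\<^sup>+p. emeasure (gauss_law (push_param L p)) A \<partial>measure_pmf W)"
  proof (intro nn_integral_cong_AE, unfold AE_measure_pmf_iff, intro ballI)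
    fix p assume "p \<in> set_pmf W"
    then have "distr (gauss_law p) borel L = gauss_law (push_param L p)"
      using W by (intro distr_gauss_law[OF L]) auto
    then have "emeasure (gauss_law (push_param L p)) A = emeasure (distr (gauss_law p) borel L) A" by simp
    also have "\<dots> = emeasure (gauss_law p) (L -` A)"
      using sets_eq_imp_space_eq[OF sets_gauss_law[of p]] by (subst emeasure_distr) auto
    finally show "emeasure (gauss_law p) (L -` A) = emeasure (gauss_law (push_param L p)) A" by simp
  qed
  also have "\<dots> = emeasure (gmix (map_pmf (push_param L) W)) A"
    by (simp add: emeasure_gmix)
  finally show "emeasure (distr (gmix W) borel L) A = emeasure (gmix (map_pmf (push_param L) W)) A" .
qed simp

text \<open>
  This allows every construction on mixtures to be carried out on finitely supported distributions
  of parameters.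
\<close>

lemma GMM_eq_gmix: "GMM = {gmix W |W. finite (set_pmf W) \<and> set_pmf W \<subseteq> gaussian_params}"
proof (intro set_eqI iffI)
  fix M :: "'a measure"
  assume "M \<in> GMM"
  then obtain K :: nat and w G where w: "\<And>k. k < K \<Longrightarrow> 0 \<le> w k" "(\<Sum>k<K. w k) = 1"
    and G: "\<And>k. k < K \<Longrightarrow> \<exists>m S. gaussian m S (G k)" and M: "sets M = sets borel"
    "\<And>A. A \<in> sets borel \<Longrightarrow> emeasure M A = (\<Sum>k<K. ennreal (w k) * emeasure (G k) A)"
    unfolding GMM_def by blast
  from G obtain m S where mS: "\<And>k. k < K \<Longrightarrow> gaussian (m k) (S k) (G k)" by metis
  define f where "f = (\<lambda>k. if k < K then w k else 0)"
  have nn: "0 \<le> f k" for k using w by (simp add: f_def)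
  have s: "(\<integral>\<^sup>+k. f k \<partial>count_space UNIV) = 1"
  proof -
    have "(\<integral>\<^sup>+k. f k \<partial>count_space UNIV) = (\<Sum>k<K. ennreal (f k))"
      by (rule nn_integral_count_space') (auto simp: f_def)
    also have "\<dots> = ennreal (\<Sum>k<K. f k)" by (rule sum_ennreal) (simp add: nn)
    finally show ?thesis by (simp add: f_def w)
  qed
  define E where "E = embed_pmf f"
  have pE: "pmf E k = f k" for k unfolding E_def by (rule pmf_embed_pmf[OF nn s])
  have sE: "set_pmf E \<subseteq> {..<K}" by (auto simp: set_pmf_eq pE f_def)
  define W where "W = map_pmf (\<lambda>k. (m k, S k)) E"
  have "M = gmix W"
  proof (rule measure_eqI)
    fix A assume "A \<in> sets M"
    then have A: "A \<in> sets borel" by (simp add: M)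
    have "emeasure (gmix W) A = (\<integral>\<^sup>+k. emeasure (gauss_law (m k, S k)) A \<partial>E)"
      using A by (simp add: emeasure_gmix W_def)
    also have "\<dots> = (\<Sum>k<K. emeasure (gauss_law (m k, S k)) A * pmf E k)"
      using sE by (intro nn_integral_measure_pmf_support) auto
    also have "\<dots> = emeasure M A"
      unfolding M(2)[OF A]
      by (intro sum.cong) (auto simp: pE f_def gaussian_eq_gauss_law[OF mS] mult.commute)
    finally show "emeasure M A = emeasure (gmix W) A" by simp
  qed (simp add: M)
  moreover have "finite (set_pmf W)"
    using finite_subset[OF sE] by (simp add: W_def)
  moreover have "set_pmf W \<subseteq> gaussian_params"
    using sE mS by (auto simp: W_def gaussian_params_def gaussian_def)
  ultimately show "M \<in> {gmix W |W. finite (set_pmf W) \<and> set_pmf W \<subseteq> gaussian_params}" by blast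
next
  fix M :: "'a measure"
  assume "M \<in> {gmix W |W. finite (set_pmf W) \<and> set_pmf W \<subseteq> gaussian_params}"
  then obtain W where W: "finite (set_pmf W)" "set_pmf W \<subseteq> gaussian_params" and M: "M = gmix W" by blast
  obtain h where h: "bij_betw h {0..<card (set_pmf W)} (set_pmf W)"
    using ex_bij_betw_nat_finite[OF W(1)] by blast
  then have h: "bij_betw h {..<card (set_pmf W)} (set_pmf W)" by (simp add: atLeast0LessThan)
  show "M \<in> GMM"
    unfolding GMM_def
  proof (intro CollectI exI conjI allI impI ballI)
    fix k assume k: "k < card (set_pmf W)"
    show "0 \<le> pmf W (h k)" by simp
    show "gaussian (fst (h k)) (snd (h k)) (gauss_law (h k))"
      using k h W(2) by (intro gaussian_gauss_law) (auto dest: bij_betwE)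
  next
    show "(\<Sum>k<card (set_pmf W). pmf W (h k)) = 1"
      using sum.reindex_bij_betw[OF h, of "pmf W"] sum_pmf_eq_1[OF W(1), of W] by simp
    show "sets M = sets borel" by (simp add: M)
    fix A :: "'a set" assume A: "A \<in> sets borel"
    have "emeasure M A = (\<Sum>p\<in>set_pmf W. emeasure (gauss_law p) A * pmf W p)"
      using W(1) by (simp add: M emeasure_gmix[OF A] nn_integral_measure_pmf_finite)
    also have "\<dots> = (\<Sum>k<card (set_pmf W). ennreal (pmf W (h k)) * emeasure (gauss_law (h k)) A)"
      using sum.reindex_bij_betw[OF h, of "\<lambda>p. emeasure (gauss_law p) A * pmf W p"]
      by (simp add: mult.commute)
    finally show "emeasure M A = (\<Sum>k<card (set_pmf W). ennreal (pmf W (h k)) * emeasure (gauss_law (h k)) A)" .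
  qed
qed

section \<open>Identifiability of finite Gaussian mixtures\<close>

text \<open>
  Two distinct parameters are indistinguishable in direction \<open>u\<close> only for
  \<open>u\<close> in a closed set with empty interior, and finitely many such sets do not cover
  the space.
\<close>

lemma gaussian_param_generic_direction:
  fixes P :: "('a::euclidean_space \<times> ('a \<Rightarrow> 'a)) set"
  assumes P: "finite P" "P \<subseteq> gaussian_params"
  shows "\<exists>u. \<forall>p\<in>P. \<forall>q\<in>P. p \<noteq> q \<longrightarrow> u \<bullet> fst p \<noteq> u \<bullet> fst q \<or> u \<bullet> snd p u \<noteq> u \<bullet> snd q u"
proof -
  define Z where "Z = (\<lambda>(p, q). {u::'a. u \<bullet> (fst p - fst q) = 0 \<and> u \<bullet> (snd p u - snd q u) = 0})"
  define I where "I = {(p, q). p \<in> P \<and> q \<in> P \<and> p \<noteq> q}"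
  have Z: "closed (Z i)" "interior (Z i) = {}" if "i \<in> I" for i
  proof -
    obtain p q where i: "i = (p, q)" by (cases i) auto
    then have pq: "p \<in> gaussian_params" "q \<in> gaussian_params" "p \<noteq> q" using that P by (auto simp: I_def)
    have c: "covariance_operator (snd p)" "covariance_operator (snd q)"
      using pq by (auto simp: gaussian_params_def)
    note l = covariance_operatorD(1)[OF c(1)] covariance_operatorD(1)[OF c(2)]
    have ct: "continuous_on UNIV (snd p)" "continuous_on UNIV (snd q)"
      using l by (auto intro!: linear_continuous_on simp: linear_conv_bounded_linear)
    show "closed (Z i)"
      unfolding Z_def i by (auto intro!: closed_Collect_conj closed_Collect_eq continuous_intros ct)
    show "interior (Z i) = {}"
    proof (rule ccontr)
      assume "interior (Z i) \<noteq> {}"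
      then obtain u e where e: "e > 0" "ball u e \<subseteq> Z i" by (auto simp: mem_interior)
      have 1: "snd p v - snd q v = 0" for v
      proof (rule symmetric_operator_zero_on_ball[where S="\<lambda>v. snd p v - snd q v", OF _ _ e(1)])
        show "linear (\<lambda>v. snd p v - snd q v)" by (rule linear_compose_sub[OF l])
        show "(snd p x - snd q x) \<bullet> y = x \<bullet> (snd p y - snd q y)" for x y
          by (simp add: inner_diff covariance_operatorD(2)[OF c(1)] covariance_operatorD(2)[OF c(2)])
        show "x \<in> ball u e \<Longrightarrow> x \<bullet> (snd p x - snd q x) = 0" for x
          using e(2) by (auto simp: Z_def i)
      qed
      define d where "d = fst p - fst q"
      define r where "r = e / (2 * (norm d + 1))"
      have n: "norm d + 1 > 0" using norm_ge_zero[of d] by linarith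
      have r: "r > 0" using e(1) n by (simp add: r_def)
      have "r * norm d \<le> r * (norm d + 1)" using r by simp
      also have "\<dots> = e / 2" unfolding r_def using n by (simp add: divide_simps)
      finally have "u + r *\<^sub>R d \<in> ball u e" "u \<in> ball u e" using r e(1) by (auto simp: dist_norm)
      then have "u + r *\<^sub>R d \<in> Z i" "u \<in> Z i" using e(2) by auto
      then have "(u + r *\<^sub>R d) \<bullet> d = 0" "u \<bullet> d = 0" by (simp_all add: Z_def i d_def)
      then have "d = 0" using r by (simp add: inner_add_left)
      then show False using 1 pq(3) by (auto simp: d_def prod_eq_iff fun_eq_iff)
    qed
  qed
  have "finite I" by (rule finite_subset[of _ "P \<times> P"]) (auto simp: I_def P)
  then have "interior (\<Union>(Z ` I)) = {}"
    using Z
  proof (induction I)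
    case (insert i F)
    have "interior (Z i \<union> \<Union>(Z ` F)) = interior (Z i)"
      using insert by (intro interior_closed_Un_empty_interior) auto
    then show ?case using insert.prems by simp
  qed simp
  then have "\<Union>(Z ` I) \<noteq> UNIV" by (metis UNIV_not_empty interior_UNIV)
  then obtain u where "u \<notin> \<Union>(Z ` I)" by blast
  then have u: "u \<notin> Z i" if "i \<in> I" for i using that by blast
  show ?thesis
  proof (intro exI[of _ u] ballI impI)
    fix p q assume "p \<in> P" "q \<in> P" "p \<noteq> q"
    then have "(p, q) \<in> I" by (simp add: I_def)
    from u[OF this] show "u \<bullet> fst p \<noteq> u \<bullet> fst q \<or> u \<bullet> snd p u \<noteq> u \<bullet> snd q u"
      by (simp add: Z_def inner_diff_right)
  qed
qed

text \<open>
  Among the terms with non-zero coefficient, the one with lexicographically largest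
  \<open>(b, a)\<close> dominates all others as \<open>r\<close> tends to infinity.
\<close>

lemma quadratic_exponentials_independent:
  fixes a b c :: "'i \<Rightarrow> real"
  assumes P: "finite P"
    and distinct: "\<And>p q. p \<in> P \<Longrightarrow> q \<in> P \<Longrightarrow> p \<noteq> q \<Longrightarrow> a p \<noteq> a q \<or> b p \<noteq> b q"
    and zero: "\<And>r. (\<Sum>p\<in>P. c p * exp (r * a p + r\<^sup>2 * b p)) = 0"
    and p: "p \<in> P"
  shows "c p = 0"
proof (rule ccontr)
  assume "c p \<noteq> 0"
  define J where "J = {p\<in>P. c p \<noteq> 0}"
  have J: "finite J" "J \<noteq> {}" using P p \<open>c p \<noteq> 0\<close> by (auto simp: J_def)
  define B where "B = Max (b ` J)"
  define K where "K = {p\<in>J. b p = B}"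
  have "B \<in> b ` J" unfolding B_def using J by (intro Max_in) auto
  then have K: "finite K" "K \<noteq> {}" using J by (auto simp: K_def)
  define A where "A = Max (a ` K)"
  have "A \<in> a ` K" unfolding A_def using K by (intro Max_in) auto
  then obtain q where q: "q \<in> J" "a q = A" "b q = B" by (auto simp: K_def)
  have le: "b i \<le> B" "b i = B \<Longrightarrow> a i \<le> A" if "i \<in> J" for i
    using that J K by (auto simp: A_def B_def K_def)
  have t: "((\<lambda>r. c i * exp (r * (a i - A) + r\<^sup>2 * (b i - B))) \<longlongrightarrow> (if i = q then c q else 0)) at_top"
    if i: "i \<in> J" for i
  proof (cases "i = q")
    case True
    then show ?thesis by (simp add: q)
  next
    case False
    then have "a i \<noteq> A \<or> b i \<noteq> B" using distinct[of i q] i q by (auto simp: J_def)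
    then have "b i - B < 0 \<or> (b i - B = 0 \<and> a i - A < 0)" using le[OF i] by auto
    moreover have "((\<lambda>r::real. C * exp (r * \<alpha> + r\<^sup>2 * \<beta>)) \<longlongrightarrow> 0) at_top" if "\<beta> < 0" for \<alpha> \<beta> C :: real
      using that by real_asymp
    moreover have "((\<lambda>r::real. C * exp (r * \<alpha>)) \<longlongrightarrow> 0) at_top" if "\<alpha> < 0" for \<alpha> C :: real
      using that by real_asymp
    ultimately show ?thesis using False by auto
  qed
  have "((\<lambda>r. \<Sum>i\<in>J. c i * exp (r * (a i - A) + r\<^sup>2 * (b i - B))) \<longlongrightarrow> (\<Sum>i\<in>J. if i = q then c q else 0)) at_top"
    by (intro tendsto_sum t)
  moreover have "(\<Sum>i\<in>J. c i * exp (r * (a i - A) + r\<^sup>2 * (b i - B))) = 0" for r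
  proof -
    have "(\<Sum>i\<in>J. c i * exp (r * (a i - A) + r\<^sup>2 * (b i - B))) =
        (\<Sum>i\<in>P. c i * exp (r * (a i - A) + r\<^sup>2 * (b i - B)))"
      using P by (intro sum.mono_neutral_left) (auto simp: J_def)
    also have "\<dots> = (\<Sum>i\<in>P. c i * exp (r * a i + r\<^sup>2 * b i)) * exp (- (r * A + r\<^sup>2 * B))"
      unfolding sum_distrib_right
      by (intro sum.cong refl) (simp add: algebra_simps flip: exp_add)
    finally show ?thesis by (simp add: zero)
  qed
  ultimately have "((\<lambda>r::real. 0) \<longlongrightarrow> c q) at_top" using J q by simp
  then have "c q = 0" by (simp add: tendsto_const_iff)
  then show False using q by (simp add: J_def)
qed

text \<open>
  The exponential moments of a mixture along a generic direction are a linear combination, with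
  the weights as coefficients, of distinct exponentials of quadratic polynomials. Exponential
  moments, unlike characteristic functions, are real exponentials, among which a dominant term can
  be singled out.
\<close>

lemma gmix_inj:
  fixes V W :: "('a::euclidean_space \<times> ('a \<Rightarrow> 'a)) pmf"
  assumes V: "finite (set_pmf V)" "set_pmf V \<subseteq> gaussian_params"
    and W: "finite (set_pmf W)" "set_pmf W \<subseteq> gaussian_params"
    and eq: "gmix V = gmix W"
  shows "V = W"
proof -
  define P where "P = set_pmf V \<union> set_pmf W"
  have P: "finite P" "P \<subseteq> gaussian_params" using V W by (auto simp: P_def)
  obtain u where u: "\<And>p q. p \<in> P \<Longrightarrow> q \<in> P \<Longrightarrow> p \<noteq> q \<Longrightarrow> u \<bullet> fst p \<noteq> u \<bullet> fst q \<or> u \<bullet> snd p u \<noteq> u \<bullet> snd q u"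
    using gaussian_param_generic_direction[OF P] by blast
  have mgf: "(\<integral>\<^sup>+x. ennreal (exp ((r *\<^sub>R u) \<bullet> x)) \<partial>gmix U) =
      ennreal (\<Sum>p\<in>P. pmf U p * exp (r * (u \<bullet> fst p) + r\<^sup>2 * (u \<bullet> snd p u / 2)))"
    if U: "set_pmf U \<subseteq> P" for U r
  proof -
    have "(\<integral>\<^sup>+x. ennreal (exp ((r *\<^sub>R u) \<bullet> x)) \<partial>gmix U) =
       (\<integral>\<^sup>+p. \<integral>\<^sup>+x. ennreal (exp ((r *\<^sub>R u) \<bullet> x)) \<partial>gauss_law p \<partial>measure_pmf U)"
      by (rule nn_integral_gmix) simp
    also have "\<dots> = (\<Sum>p\<in>P. (\<integral>\<^sup>+x. ennreal (exp ((r *\<^sub>R u) \<bullet> x)) \<partial>gauss_law p) * ennreal (pmf U p))"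
      using U P by (intro nn_integral_measure_pmf_support) auto
    also have "\<dots> = (\<Sum>p\<in>P. ennreal (pmf U p * exp (r * (u \<bullet> fst p) + r\<^sup>2 * (u \<bullet> snd p u / 2))))"
    proof (intro sum.cong refl)
      fix p assume "p \<in> P"
      then have p: "p \<in> gaussian_params" using P by auto
      have "(r *\<^sub>R u) \<bullet> snd p (r *\<^sub>R u) / 2 = r\<^sup>2 * (u \<bullet> snd p u / 2)"
        using p by (simp add: gaussian_params_def linear_scale[OF covariance_operatorD(1)] power2_eq_square)
      then show "(\<integral>\<^sup>+x. ennreal (exp ((r *\<^sub>R u) \<bullet> x)) \<partial>gauss_law p) * ennreal (pmf U p) =
         ennreal (pmf U p * exp (r * (u \<bullet> fst p) + r\<^sup>2 * (u \<bullet> snd p u / 2)))"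
        unfolding gauss_law_exponential_moment[OF p] by (simp add: mult.commute ennreal_mult)
    qed
    finally show ?thesis by simp
  qed
  have "pmf V p - pmf W p = 0" if "p \<in> P" for p
  proof (rule quadratic_exponentials_independent[OF P(1) _ _ that])
    show "p \<in> P \<Longrightarrow> q \<in> P \<Longrightarrow> p \<noteq> q \<Longrightarrow> u \<bullet> fst p \<noteq> u \<bullet> fst q \<or> u \<bullet> snd p u / 2 \<noteq> u \<bullet> snd q u / 2" for p q
      using u[of p q] by simp
    fix r
    have sub: "set_pmf V \<subseteq> P" "set_pmf W \<subseteq> P" by (auto simp: P_def)
    have "ennreal (\<Sum>p\<in>P. pmf V p * exp (r * (u \<bullet> fst p) + r\<^sup>2 * (u \<bullet> snd p u / 2))) =
        ennreal (\<Sum>p\<in>P. pmf W p * exp (r * (u \<bullet> fst p) + r\<^sup>2 * (u \<bullet> snd p u / 2)))"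
      unfolding mgf[OF sub(1), symmetric] mgf[OF sub(2), symmetric] eq ..
    then have "(\<Sum>p\<in>P. pmf V p * exp (r * (u \<bullet> fst p) + r\<^sup>2 * (u \<bullet> snd p u / 2))) =
        (\<Sum>p\<in>P. pmf W p * exp (r * (u \<bullet> fst p) + r\<^sup>2 * (u \<bullet> snd p u / 2)))"
      by (subst (asm) ennreal_inj) (auto intro!: sum_nonneg)
    then show "(\<Sum>p\<in>P. (pmf V p - pmf W p) * exp (r * (u \<bullet> fst p) + r\<^sup>2 * (u \<bullet> snd p u / 2))) = 0"
      by (simp add: left_diff_distrib sum_subtractf)
  qed
  moreover have "pmf V p = 0 \<and> pmf W p = 0" if "p \<notin> P" for p
    using that by (auto simp: P_def set_pmf_eq)
  ultimately show ?thesis by (intro pmf_eqI) (metis eq_iff_diff_eq_0)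
qed

section \<open>Gluing\<close>

lemma adjoint_snd: "adjoint (snd :: 'a::euclidean_space \<times> 'b::euclidean_space \<Rightarrow> 'b) = (\<lambda>u. (0, u))"
  by (rule adjoint_unique) (simp add: inner_prod_def)

lemma adjoint_vec_nth: "adjoint (\<lambda>x :: 'a::euclidean_space ^ 'j::finite. x $ j) = axis j"
  by (rule adjoint_unique) (simp add: inner_axis)

lemma linear_vec_component: "linear (\<lambda>x :: 'a::euclidean_space ^ 'j::finite. x $ j)"
  by (rule linearI) simp_all

lemma covariance_operator_block_diagonal:
  fixes S :: "'j::finite \<Rightarrow> 'a::euclidean_space \<Rightarrow> 'a"
  assumes "\<And>j. covariance_operator (S j)"
  shows "covariance_operator (\<lambda>x. \<chi> j. S j (x $ j))"
  unfolding covariance_operator_def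
proof (intro conjI allI)
  note S = covariance_operatorD[OF assms]
  show "linear (\<lambda>x. \<chi> j. S j (x $ j))"
    by (rule linearI) (simp_all add: vec_eq_iff linear_add[OF S(1)] linear_scale[OF S(1)])
  show "(\<chi> j. S j (x $ j)) \<bullet> y = x \<bullet> (\<chi> j. S j (y $ j))" for x y
    by (simp add: inner_vec_def S(2))
  show "0 \<le> x \<bullet> (\<chi> j. S j (x $ j))" for x
    by (simp add: inner_vec_def S(3) sum_nonneg)
qed

lemma covariance_operator_prod:
  assumes "covariance_operator S" "covariance_operator T"
  shows "covariance_operator (\<lambda>x. (S (fst x), T (snd x)))"
  unfolding covariance_operator_def
proof (intro conjI allI)
  note S = covariance_operatorD[OF assms(1)] and T = covariance_operatorD[OF assms(2)]
  show "linear (\<lambda>x. (S (fst x), T (snd x)))"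
    by (rule linearI) (simp_all add: linear_add[OF S(1)] linear_scale[OF S(1)] linear_add[OF T(1)] linear_scale[OF T(1)])
  show "(S (fst x), T (snd x)) \<bullet> y = x \<bullet> (S (fst y), T (snd y))" for x y
    by (simp add: inner_prod_def S(2) T(2))
  show "0 \<le> x \<bullet> (S (fst x), T (snd x))" for x
    by (simp add: inner_prod_def S(3) T(3))
qed

text \<open>
  Independent components: a block diagonal covariance has the prescribed marginals.
\<close>

lemma product_gaussian_param:
  fixes p :: "'j::finite \<Rightarrow> 'a::euclidean_space \<times> ('a \<Rightarrow> 'a)"
  assumes "\<And>j. p j \<in> gaussian_params"
  shows "\<exists>r\<in>gaussian_params. \<forall>j. push_param (\<lambda>x. x $ j) r = p j"
proof (intro bexI allI)
  let ?r = "((\<chi> j. fst (p j)), (\<lambda>x. \<chi> j. snd (p j) (x $ j)))"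
  show "?r \<in> gaussian_params"
    using covariance_operator_block_diagonal[of "\<lambda>j. snd (p j)"] assms by (simp add: gaussian_params_def)
  show "push_param (\<lambda>x. x $ j) ?r = p j" for j
    by (simp add: push_param_def adjoint_vec_nth prod_eq_iff)
qed

text \<open>
  If \<open>(X, Y)\<close> has covariance \<open>S\<close>, then
  \<open>a \<bullet> X + T a \<bullet> Y\<close> is uncorrelated with \<open>Y\<close>, so
  \<open>- T\<^sup>T\<close> is the regression of \<open>X\<close> on \<open>Y\<close>. For
  singular covariance \<open>Q\<close> of \<open>Y\<close>, the equation for \<open>T a\<close> is
  solvable because the right-hand side is orthogonal to the kernel of \<open>Q\<close>, by
  Cauchy--Schwarz.
\<close>

lemma covariance_operator_regression:
  fixes S :: "'a::euclidean_space \<times> 'b::euclidean_space \<Rightarrow> 'a \<times> 'b"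
  assumes "covariance_operator S"
  shows "\<exists>T. linear T \<and> (\<forall>a. snd (S (a, T a)) = 0)"
proof -
  note S = covariance_operatorD[OF assms]
  define Q where "Q = (\<lambda>b. snd (S (0, b)))"
  have Q: "linear Q"
  proof (rule linearI)
    show "Q (x + y) = Q x + Q y" for x y
      using linear_add[OF S(1), of "(0, x)" "(0, y)"] by (simp add: Q_def)
    show "Q (c *\<^sub>R x) = c *\<^sub>R Q x" for c x
      using linear_scale[OF S(1), of c "(0, x)"] by (simp add: Q_def)
  qed
  have Qs: "Q x \<bullet> y = x \<bullet> Q y" for x y
    using S(2)[of "(0, x)" "(0, y)"] by (simp add: Q_def inner_prod_def)
  have add: "S (a, b) = S (a, 0) + S (0, b)" for a b
    using linear_add[OF S(1), of "(a, 0)" "(0, b)"] by simp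
  have "\<exists>b. snd (S (a, b)) = 0" for a
  proof -
    define v where "v = snd (S (a, 0))"
    obtain y z where yz: "y \<in> span (range Q)" "\<And>w. w \<in> span (range Q) \<Longrightarrow> orthogonal z w" "v = y + z"
      using orthogonal_subspace_decomp_exists[of "range Q" v] by metis
    have "span (range Q) = range Q"
      using linear_subspace_image[OF Q subspace_UNIV] by (simp add: span_eq_iff)
    then have "y \<in> range Q" using yz(1) by (simp only:)
    then obtain b where b: "y = Q b" by auto
    have "Q z \<bullet> Q z = z \<bullet> Q (Q z)" by (rule Qs)
    also have "\<dots> = 0" using yz(2)[of "Q (Q z)"] by (simp add: orthogonal_def span_base)
    finally have "Q z = 0" by simp
    then have "(0, z) \<bullet> S (0, z) = 0" by (simp add: inner_prod_def Q_def)
    then have "S (0, z) = 0" by (rule covariance_operator_kernel[OF assms])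
    then have "z \<bullet> v = 0"
      using S(2)[of "(0, z)" "(a, 0)"] by (simp add: v_def inner_prod_def)
    moreover have "z \<bullet> y = 0" using yz(1,2) by (simp add: orthogonal_def)
    ultimately have "z = 0" using yz(3) by (simp add: inner_add_right)
    then have "snd (S (a, - b)) = 0"
      using yz(3) b add[of a "- b"] linear_neg[OF Q, of b] by (simp add: v_def Q_def)
    then show ?thesis by blast
  qed
  then obtain f where f: "snd (S (a, f a)) = 0" for a by metis
  \<comment> \<open>The pointwise solutions need not depend linearly on \<open>a\<close>; their values on the basis are extended linearly.\<close>
  obtain T where T: "linear T" "\<And>b. b \<in> Basis \<Longrightarrow> T b = f b"
    using linear_independent_extend[OF independent_Basis, of f] by blast
  have l: "linear (\<lambda>a. snd (S (a, T a)))"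
  proof (rule linearI)
    show "snd (S (x + y, T (x + y))) = snd (S (x, T x)) + snd (S (y, T y))" for x y
      using linear_add[OF S(1), of "(x, T x)" "(y, T y)"] linear_add[OF T(1), of x y] by simp
    show "snd (S (c *\<^sub>R x, T (c *\<^sub>R x))) = c *\<^sub>R snd (S (x, T x))" for c x
      using linear_scale[OF S(1), of c "(x, T x)"] linear_scale[OF T(1), of c x] by simp
  qed
  have "(\<lambda>a. snd (S (a, T a))) = (\<lambda>_. 0)"
    by (rule linear_eq_stdbasis[OF l linear_zero]) (simp add: T f)
  then show ?thesis using T(1) by (metis (no_types, lifting))
qed

text \<open>
  Gaussian laws of \<open>(X\<^sub>j, Y)\<close> with a common law of \<open>Y\<close> are the
  marginals of a joint Gaussian law of \<open>((X\<^sub>j)\<^sub>j, Y)\<close>: write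
  \<open>X\<^sub>j = A\<^sub>j Y + R\<^sub>j\<close> with a residual \<open>R\<^sub>j\<close>
  uncorrelated with \<open>Y\<close>, and take all residuals and \<open>Y\<close> independent.
\<close>

lemma glue_gaussian_params:
  fixes p :: "'j::finite \<Rightarrow> ('a::euclidean_space \<times> 'b::euclidean_space) \<times> ('a \<times> 'b \<Rightarrow> 'a \<times> 'b)"
  assumes p: "\<And>j. p j \<in> gaussian_params" and q: "\<And>j. push_param snd (p j) = q"
  shows "\<exists>r\<in>gaussian_params. \<forall>j. push_param (\<lambda>x. (fst x $ j, snd x)) r = p j"
proof -
  have S: "covariance_operator (snd (p j))" for j using p by (simp add: gaussian_params_def)
  obtain T where T: "\<And>j. linear (T j)" "\<And>j a. snd (snd (p j) (a, T j a)) = 0"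
    using covariance_operator_regression[OF S] by metis
  have qg: "q \<in> gaussian_params"
    using push_param_in_gaussian_params[of snd "p undefined"] p q linear_snd by metis
  have q1: "snd (fst (p j)) = fst q" and q2: "snd (snd (p j) (0, c)) = snd q c" for j c
    using q[of j] by (auto simp: push_param_def adjoint_snd)
  \<comment> \<open>Independent copies of all pairs, together with an independent \<open>Y\<close>.\<close>
  define z where "z = (((\<chi> j. fst (p j)), fst q),
     (\<lambda>w :: (('a \<times> 'b) ^ 'j) \<times> 'b. ((\<chi> j. snd (p j) (fst w $ j)), snd q (snd w))))"
  have z: "z \<in> gaussian_params"
    using covariance_operator_prod[OF covariance_operator_block_diagonal[of "\<lambda>j. snd (p j)"], of "snd q"] S qg
    by (simp add: z_def gaussian_params_def)
  \<comment> \<open>Each pair is turned into its residual \<open>X\<^sub>j + T\<^sub>j\<^sup>T Y\<^sub>j\<close>, to which the regression on the common \<open>Y\<close> is added.\<close>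
  define G where "G = (\<lambda>w :: (('a \<times> 'b) ^ 'j) \<times> 'b.
     ((\<chi> j. fst (fst w $ j) + adjoint (T j) (snd (fst w $ j)) - adjoint (T j) (snd w)), snd w))"
  note aT = adjoint_linear[OF T(1)]
  have G: "linear G"
    unfolding G_def by (rule linearI)
      (simp_all add: vec_eq_iff linear_add[OF aT] linear_scale[OF aT] algebra_simps)
  have K: "linear (\<lambda>x :: ('a ^ 'j) \<times> 'b. (fst x $ j, snd x))" for j
    by (rule linearI) simp_all
  have "push_param (\<lambda>x. (fst x $ j, snd x)) (push_param G z) = p j" for j
  proof -
    define H where "H = (\<lambda>w :: (('a \<times> 'b) ^ 'j) \<times> 'b.
     (fst (fst w $ j) + adjoint (T j) (snd (fst w $ j)) - adjoint (T j) (snd w), snd w))"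
    have KG: "(\<lambda>w. (fst (G w) $ j, snd (G w))) = H" by (simp add: G_def H_def)
    have H: "linear H" using linear_compose[OF G K, of j] by (simp add: KG[symmetric] o_def)
    have aH: "adjoint H = (\<lambda>u. (axis j (fst u, T j (fst u)), snd u - T j (fst u)))"
      by (rule adjoint_unique)
        (auto simp: H_def inner_prod_def inner_axis inner_simps adjoint_clauses[OF T(1)])
    have "push_param H z = p j"
    proof (rule prod_eqI)
      show "fst (push_param H z) = fst (p j)"
        by (simp add: push_param_def H_def z_def q1 prod_eq_iff)
      show "snd (push_param H z) = snd (p j)"
      proof (rule covariance_operator_eqI)
        show "covariance_operator (snd (push_param H z))"
          using push_param_in_gaussian_params[OF H z] by (simp add: gaussian_params_def)
        show "covariance_operator (snd (p j))" by (rule S)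
        fix u :: "'a \<times> 'b"
        obtain a b where u: "u = (a, b)" by (cases u) auto
        define c where "c = b - T j a"
        note Sj = covariance_operatorD[OF S[of j]]
        \<comment> \<open>The two summands are orthogonal for \<open>snd (p j)\<close>, by the choice of \<open>T j\<close>.\<close>
        have uc: "u = (a, T j a) + (0, c)" by (simp add: u c_def)
        have "u \<bullet> snd (push_param H z) u = adjoint H u \<bullet> snd z (adjoint H u)"
          by (simp add: push_param_def adjoint_clauses[OF H] inner_commute)
        also have "\<dots> = (a, T j a) \<bullet> snd (p j) (a, T j a) + c \<bullet> snd q c"
          by (simp add: aH u z_def inner_prod_def[of "(axis _ _, _)"] inner_axis' c_def)
        also have "\<dots> = u \<bullet> snd (p j) u"
        proof -
          have 1: "(0, c) \<bullet> snd (p j) (a, T j a) = 0" by (simp add: inner_prod_def T(2))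
          have 2: "(a, T j a) \<bullet> snd (p j) (0, c) = 0"
            using Sj(2)[of "(a, T j a)" "(0, c)"] 1 by (simp add: inner_commute)
          have 3: "(0, c) \<bullet> snd (p j) (0, c) = c \<bullet> snd q c" by (simp add: inner_prod_def q2)
          show ?thesis unfolding uc linear_add[OF Sj(1)] inner_add_left inner_add_right 1 2 3 by simp
        qed
        finally show "u \<bullet> snd (push_param H z) u = u \<bullet> snd (p j) u" .
      qed
    qed
    then show ?thesis by (simp add: push_param_compose[OF G K] KG)
  qed
  then show ?thesis using push_param_in_gaussian_params[OF G z] by blast
qed

text \<open>
  Sample the common value \<open>q\<close> from \<open>U\<close>, then sample the elements
  \<open>p j\<close> independently from the \<open>V j\<close> conditioned on
  \<open>f (p j) = q\<close>, and combine them into an element of \<open>R\<close>.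
\<close>

lemma glue_pmf:
  fixes V :: "'j::finite \<Rightarrow> 'x pmf" and f :: "'x \<Rightarrow> 'y" and h :: "'j \<Rightarrow> 'r \<Rightarrow> 'x"
  assumes V: "\<And>j. map_pmf f (V j) = U"
    and fin: "\<And>j. finite (set_pmf (V j))"
    and glue: "\<And>q p. (\<And>j. p j \<in> set_pmf (V j)) \<Longrightarrow> (\<And>j. f (p j) = q) \<Longrightarrow> \<exists>r\<in>R. \<forall>j. h j r = p j"
  shows "\<exists>W. finite (set_pmf W) \<and> set_pmf W \<subseteq> R \<and> (\<forall>j. map_pmf (h j) W = V j)"
proof -
  define g where "g = (\<lambda>p. SOME r. r \<in> R \<and> (\<forall>j. h j r = p j))"
  have g: "g p \<in> R" "h j (g p) = p j" if "\<And>j. p j \<in> set_pmf (V j)" "\<And>j. f (p j) = q" for p q j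
  proof -
    have "\<exists>r. r \<in> R \<and> (\<forall>j. h j r = p j)" using glue[OF that] by blast
    from someI_ex[OF this] show "g p \<in> R" "h j (g p) = p j" by (auto simp: g_def)
  qed
  define C where "C = (\<lambda>q. Pi_pmf UNIV undefined (\<lambda>j. cond_pmf (V j) {x. f x = q}))"
  have ne: "set_pmf (V j) \<inter> {x. f x = q} \<noteq> {}" if "q \<in> set_pmf U" for j q
    using that unfolding V[of j, symmetric] by auto
  have C: "p j \<in> set_pmf (V j)" "f (p j) = q" if "p \<in> set_pmf (C q)" "q \<in> set_pmf U" for p q j
    using that ne[OF that(2)] by (auto simp: C_def set_Pi_pmf PiE_dflt_def set_cond_pmf)
  define W where "W = bind_pmf U (\<lambda>q. map_pmf g (C q))"
  have "map_pmf (h j) W = V j" for j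
  proof -
    have "map_pmf (h j) W = bind_pmf U (\<lambda>q. map_pmf (\<lambda>p. h j (g p)) (C q))"
      by (simp add: W_def map_bind_pmf pmf.map_comp o_def)
    also have "\<dots> = bind_pmf U (\<lambda>q. map_pmf (\<lambda>p. p j) (C q))"
      by (intro bind_pmf_cong refl map_pmf_cong) (rule g(2), (erule (1) C)+)
    also have "\<dots> = bind_pmf U (\<lambda>q. cond_pmf (V j) {x. f x = q})"
      by (simp add: C_def Pi_pmf_component)
    also have "\<dots> = V j"
    proof (rule bind_cond_pmf_cancel)
      show "set_pmf (V j) \<inter> {x. f x = q} \<noteq> {}" if "q \<in> set_pmf U" for q by (rule ne[OF that])
      show "set_pmf U \<inter> {q. f y = q} \<noteq> {}" if "y \<in> set_pmf (V j)" for y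
        using that unfolding V[of j, symmetric] by auto
      fix q y assume "f y = q"
      then show "measure (V j) {y. f y = q} = measure U {q. f y = q}"
        unfolding V[of j, symmetric] by (simp add: vimage_def eq_commute)
    qed
    finally show ?thesis .
  qed
  moreover have "finite (set_pmf W)"
  proof -
    have "finite (set_pmf U)" using fin unfolding V[of undefined, symmetric] by simp
    moreover have "finite (set_pmf (C q))" if "q \<in> set_pmf U" for q
    proof (rule finite_subset)
      show "set_pmf (C q) \<subseteq> (PiE UNIV (\<lambda>j. set_pmf (V j)))" using C[OF _ that] by auto
      show "finite (PiE UNIV (\<lambda>j. set_pmf (V j)))" by (rule finite_PiE) (auto simp: fin)
    qed
    ultimately show ?thesis by (simp add: W_def)
  qed
  moreover have "set_pmf W \<subseteq> R" using g(1) C by (auto simp: W_def)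
  ultimately show ?thesis by blast
qed

section \<open>Existence of optimal multi-marginal plans\<close>

lemma compact_PiE_UNIV:
  fixes A :: "'i \<Rightarrow> 'a::topological_space set"
  assumes "\<And>i. compact (A i)"
  shows "compact (PiE UNIV A)"
  using compactin_PiE[of "\<lambda>_. euclidean" UNIV A] assms
  by (simp add: euclidean_product_topology)

text \<open>
  The couplings of finitely supported distributions, viewed as functions on the finite set of
  tuples, form a compact set and the cost is a linear functional on it.
\<close>

lemma optimal_pmf_coupling:
  fixes \<mu> :: "'j::finite \<Rightarrow> 'x pmf" and c :: "('j \<Rightarrow> 'x) \<Rightarrow> real"
  assumes fin: "\<And>j. finite (set_pmf (\<mu> j))" and c: "\<And>t. 0 \<le> c t"
  shows "\<exists>V. (\<forall>j. map_pmf (\<lambda>t. t j) V = \<mu> j) \<and>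
    (\<forall>V'. (\<forall>j. map_pmf (\<lambda>t. t j) V' = \<mu> j) \<longrightarrow>
      (\<integral>\<^sup>+t. ennreal (c t) \<partial>measure_pmf V) \<le> (\<integral>\<^sup>+t. ennreal (c t) \<partial>measure_pmf V'))"
proof -
  define T where "T = PiE UNIV (\<lambda>j. set_pmf (\<mu> j))"
  have T: "finite T" unfolding T_def by (rule finite_PiE) (auto simp: fin)
  define F where "F = {g. (\<forall>t. 0 \<le> g t) \<and> (\<Sum>t\<in>T. g t) = 1 \<and>
      (\<forall>j x. (\<Sum>t\<in>{t\<in>T. t j = x}. g t) = pmf (\<mu> j) x)}"
  define B where "B = PiE UNIV (\<lambda>t. if t \<in> T then {0..1} else {0::real})"
  have co: "continuous_on UNIV (\<lambda>g :: ('j \<Rightarrow> 'x) \<Rightarrow> real. \<Sum>t\<in>A. g t * k t)" for A k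
    by (intro continuous_intros continuous_on_product_coordinates)
  have "compact B" unfolding B_def by (rule compact_PiE_UNIV) auto
  moreover have "closed F"
    unfolding F_def
    by (intro closed_Collect_conj closed_Collect_all closed_Collect_le closed_Collect_eq
        continuous_intros continuous_on_product_coordinates co[where k="\<lambda>_. 1", simplified])
  ultimately have cpt: "compact (B \<inter> F)" by (rule compact_Int_closed)
  have couplingD: "set_pmf V \<subseteq> T" "pmf V \<in> B \<inter> F" if V: "\<forall>j. map_pmf (\<lambda>t. t j) V = \<mu> j" for V
  proof -
    show sub: "set_pmf V \<subseteq> T"
    proof
      fix t assume "t \<in> set_pmf V"
      then have "t j \<in> set_pmf (map_pmf (\<lambda>t. t j) V)" for j by auto
      then show "t \<in> T" using V by (auto simp: T_def)
    qed
    have "(\<Sum>t\<in>{t\<in>T. t j = x}. pmf V t) = pmf (\<mu> j) x" for j x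
    proof -
      have "pmf (\<mu> j) x = pmf (map_pmf (\<lambda>t. t j) V) x" using V by simp
      also have "\<dots> = measure V {t. t j = x}" by (simp add: pmf_map vimage_def)
      also have "\<dots> = measure V {t\<in>T. t j = x}"
        using sub by (intro measure_eq_AE) (auto simp: AE_measure_pmf_iff)
      also have "\<dots> = (\<Sum>t\<in>{t\<in>T. t j = x}. pmf V t)"
        using T by (intro measure_measure_pmf_finite) auto
      finally show ?thesis by simp
    qed
    moreover have "(\<Sum>t\<in>T. pmf V t) = 1" by (rule sum_pmf_eq_1[OF T sub])
    moreover have "pmf V \<in> B" using sub by (auto simp: B_def pmf_le_1 set_pmf_eq)
    ultimately show "pmf V \<in> B \<inter> F" by (simp add: F_def)
  qed
  have cost: "(\<integral>\<^sup>+t. ennreal (c t) \<partial>measure_pmf V) = ennreal (\<Sum>t\<in>T. pmf V t * c t)" if "set_pmf V \<subseteq> T" for V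
  proof -
    have "(\<integral>\<^sup>+t. ennreal (c t) \<partial>measure_pmf V) = (\<Sum>t\<in>T. ennreal (c t) * pmf V t)"
      using that T by (intro nn_integral_measure_pmf_support) auto
    also have "\<dots> = (\<Sum>t\<in>T. ennreal (pmf V t * c t))"
      by (intro sum.cong refl) (simp add: c ennreal_mult mult.commute)
    also have "\<dots> = ennreal (\<Sum>t\<in>T. pmf V t * c t)" by (rule sum_ennreal) (simp add: c)
    finally show ?thesis .
  qed
  have "\<forall>j. map_pmf (\<lambda>t. t j) (Pi_pmf UNIV undefined \<mu>) = \<mu> j" by (simp add: Pi_pmf_component)
  from couplingD(2)[OF this] have ne: "B \<inter> F \<noteq> {}" by blast
  obtain g where g: "g \<in> B \<inter> F"
    and g_min: "\<And>g'. g' \<in> B \<inter> F \<Longrightarrow> (\<Sum>t\<in>T. g t * c t) \<le> (\<Sum>t\<in>T. g' t * c t)"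
    using continuous_attains_inf[OF cpt ne continuous_on_subset[OF co[where A=T and k=c] subset_UNIV]] by blast
  have nn: "0 \<le> g t" and g1: "(\<Sum>t\<in>T. g t) = 1"
    and gm: "(\<Sum>t\<in>{t\<in>T. t j = x}. g t) = pmf (\<mu> j) x" for t j x
    using g by (auto simp: F_def)
  have gT: "g t = 0" if "t \<notin> T" for t
    using g that by (auto simp: B_def PiE_def Pi_def split: if_splits)
  have int: "(\<integral>\<^sup>+t. ennreal (g t) \<partial>count_space UNIV) = 1"
  proof -
    have "(\<integral>\<^sup>+t. ennreal (g t) \<partial>count_space UNIV) = (\<Sum>t\<in>T. ennreal (g t))"
      using T gT by (intro nn_integral_count_space') auto
    then show ?thesis using g1 nn by simp
  qed
  define V where "V = embed_pmf g"
  have pV: "pmf V = g" unfolding V_def by (rule ext) (rule pmf_embed_pmf[OF nn int])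
  have VT: "set_pmf V \<subseteq> T" using gT by (auto simp: set_pmf_eq pV)
  have "map_pmf (\<lambda>t. t j) V = \<mu> j" for j
  proof (rule pmf_eqI)
    fix x
    have "pmf (map_pmf (\<lambda>t. t j) V) x = measure V {t. t j = x}" by (simp add: pmf_map vimage_def)
    also have "\<dots> = measure V {t\<in>T. t j = x}"
      using VT by (intro measure_eq_AE) (auto simp: AE_measure_pmf_iff)
    also have "\<dots> = (\<Sum>t\<in>{t\<in>T. t j = x}. pmf V t)"
      using T by (intro measure_measure_pmf_finite) auto
    finally show "pmf (map_pmf (\<lambda>t. t j) V) x = pmf (\<mu> j) x" by (simp add: pV gm)
  qed
  moreover have "(\<integral>\<^sup>+t. ennreal (c t) \<partial>measure_pmf V) \<le> (\<integral>\<^sup>+t. ennreal (c t) \<partial>measure_pmf V')"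
    if V': "\<forall>j. map_pmf (\<lambda>t. t j) V' = \<mu> j" for V'
    unfolding cost[OF VT] cost[OF couplingD(1)[OF V']] pV
    by (intro ennreal_leI g_min couplingD(2)[OF V'])
  ultimately show ?thesis by blast
qed

text \<open>
  The mean is forced by the marginals, and so are the diagonal blocks of the covariance. By
  positivity the diagonal entries bound all other entries, so the admissible covariances form a
  compact set in the topology of pointwise convergence.
\<close>

lemma optimal_gaussian_param_coupling:
  fixes p :: "'j::finite \<Rightarrow> 'a::euclidean_space \<times> ('a \<Rightarrow> 'a)" and F :: "_ \<Rightarrow> real"
  assumes p: "\<And>j. p j \<in> gaussian_params"
    and F: "\<And>m. continuous_on UNIV (\<lambda>S. F (m, S))"
  shows "\<exists>r\<in>gaussian_params. (\<forall>j. push_param (\<lambda>x. x $ j) r = p j) \<and>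
    (\<forall>r'\<in>gaussian_params. (\<forall>j. push_param (\<lambda>x. x $ j) r' = p j) \<longrightarrow> F r \<le> F r')"
proof -
  define m where "m = (\<chi> j. fst (p j))"
  define C where "C = {S. covariance_operator S \<and> (\<forall>j u. S (axis j u) $ j = snd (p j) u)}"
  have feas: "(r \<in> gaussian_params \<and> (\<forall>j. push_param (\<lambda>x. x $ j) r = p j)) \<longleftrightarrow> (fst r = m \<and> snd r \<in> C)" for r
    by (auto simp: gaussian_params_def push_param_def adjoint_vec_nth prod_eq_iff m_def C_def vec_eq_iff fun_eq_iff)
  \<comment> \<open>On basis vectors, which have a single non-zero block, \<open>t\<close> is the diagonal entry common to all of \<open>C\<close>.\<close>
  define t where "t = (\<lambda>b. \<Sum>j\<in>UNIV. b $ j \<bullet> snd (p j) (b $ j))"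
  define K where "K = (\<lambda>x. \<Sum>b\<in>Basis. \<bar>x \<bullet> b\<bar> * (\<Sum>b'\<in>Basis. (t b + t b') / 2))"
  have bound: "norm (S x) \<le> K x" if "S \<in> C" for S x
  proof -
    have c: "covariance_operator S" using that by (simp add: C_def)
    note S = covariance_operatorD[OF c]
    have tb: "b \<bullet> S b = t b" if "b \<in> Basis" for b
    proof -
      obtain i e where b: "b = axis i e" using \<open>b \<in> Basis\<close> by (auto simp: Basis_vec_def)
      have "b \<bullet> S b = e \<bullet> snd (p i) e"
        using \<open>S \<in> C\<close> by (simp add: b inner_axis' C_def)
      moreover have "t b = (\<Sum>j\<in>UNIV. if j = i then e \<bullet> snd (p i) e else 0)"
        unfolding t_def by (intro sum.cong refl) (auto simp: b axis_def)
      ultimately show ?thesis by simp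
    qed
    have off: "\<bar>S b \<bullet> b'\<bar> \<le> (t b + t b') / 2" if "b \<in> Basis" "b' \<in> Basis" for b b'
    proof -
      have "0 \<le> (b + b') \<bullet> S (b + b')" "0 \<le> (b - b') \<bullet> S (b - b')" by (rule S(3))+
      then show ?thesis
        using S(2)[of b b'] tb[OF that(1)] tb[OF that(2)]
        by (simp add: linear_add[OF S(1)] linear_diff[OF S(1)] inner_simps inner_commute)
    qed
    have "S x = S (\<Sum>b\<in>Basis. (x \<bullet> b) *\<^sub>R b)" by (simp add: euclidean_representation)
    also have "\<dots> = (\<Sum>b\<in>Basis. (x \<bullet> b) *\<^sub>R S b)"
      by (simp add: linear_sum[OF S(1)] linear_scale[OF S(1)])
    also have "norm \<dots> \<le> (\<Sum>b\<in>Basis. \<bar>x \<bullet> b\<bar> * norm (S b))"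
      by (rule norm_sum[THEN order_trans]) simp
    also have "\<dots> \<le> K x"
      unfolding K_def
      by (intro sum_mono mult_left_mono norm_le_l1[THEN order_trans] off) auto
    finally show ?thesis .
  qed
  have ev: "continuous_on UNIV (\<lambda>S :: 'a ^ 'j \<Rightarrow> 'a ^ 'j. S x)" for x
    by (rule continuous_on_product_coordinates)
  have "C = PiE UNIV (\<lambda>x. cball 0 (K x)) \<inter> C" using bound by auto
  moreover have "closed C"
    unfolding C_def covariance_operator_def linear_iff
    by (intro closed_Collect_conj closed_Collect_all closed_Collect_le closed_Collect_eq
        continuous_intros ev)
  ultimately have cpt: "compact C"
    by (metis compact_Int_closed compact_PiE_UNIV compact_cball)
  obtain r0 where "r0 \<in> gaussian_params" "\<forall>j. push_param (\<lambda>x. x $ j) r0 = p j"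
    using product_gaussian_param[of p] p by blast
  then have "C \<noteq> {}" using feas[of r0] by blast
  then obtain S where S: "S \<in> C" "\<And>S'. S' \<in> C \<Longrightarrow> F (m, S) \<le> F (m, S')"
    using continuous_attains_inf[OF cpt _ continuous_on_subset[OF F subset_UNIV]] by metis
  show ?thesis
  proof (intro bexI[of _ "(m, S)"] conjI ballI impI)
    show "\<forall>j. push_param (\<lambda>x. x $ j) (m, S) = p j" "(m, S) \<in> gaussian_params" using feas[of "(m, S)"] S(1) by auto
    fix r' assume "r' \<in> gaussian_params" "\<forall>j. push_param (\<lambda>x. x $ j) r' = p j"
    then have "fst r' = m" "snd r' \<in> C" using feas[of r'] by auto
    then show "F (m, S) \<le> F r'" using S(2)[of "snd r'"] by (cases r') auto
  qed
qed

text \<open>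
  The cost is a weighted sum of squares of the linear functionals
  \<open>x \<mapsto> (x\<^sub>i - B x) \<bullet> e\<close>, so its integral against a Gaussian law
  is this expression in the mean and the covariance.
\<close>

definition gaussian_param_cost :: "('j::finite \<Rightarrow> real) \<Rightarrow> ('a::euclidean_space ^ 'j) \<times> ('a ^ 'j \<Rightarrow> 'a ^ 'j) \<Rightarrow> real" where
  "gaussian_param_cost lam p = (\<Sum>i\<in>UNIV. \<Sum>e\<in>Basis. lam i *
     (let u = adjoint (\<lambda>x. x $ i - bary lam x) e in (u \<bullet> fst p)\<^sup>2 + u \<bullet> snd p u))"

lemma linear_bary: "linear (bary lam)"
  unfolding bary_def by (rule linearI) (simp_all add: algebra_simps sum.distrib scaleR_sum_right)

lemma borel_measurable_mm_cost[measurable]: "mm_cost lam \<in> borel_measurable borel"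
  unfolding mm_cost_def bary_def by (intro borel_measurable_continuous_onI continuous_intros)

lemma nn_integral_mm_cost_gauss_law:
  assumes lam: "\<And>j. 0 \<le> lam j" and p: "p \<in> gaussian_params"
  shows "(\<integral>\<^sup>+x. ennreal (mm_cost lam (x :: 'a::euclidean_space ^ 'j::finite)) \<partial>gauss_law p) =
    ennreal (gaussian_param_cost lam p)"
proof -
  define u where "u = (\<lambda>i. adjoint (\<lambda>x :: 'a ^ 'j. x $ i - bary lam x))"
  have u: "(x $ i - bary lam x) \<bullet> e = u i e \<bullet> x" for x i e
    using adjoint_works[OF linear_compose_sub[OF linear_vec_component linear_bary], of x i lam e]
    by (simp add: u_def inner_commute)
  have s: "0 \<le> v \<bullet> snd p v" for v using p by (simp add: gaussian_params_def covariance_operatorD)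
  have norm_sq: "(norm v)\<^sup>2 = (\<Sum>e\<in>Basis. (v \<bullet> e)\<^sup>2)" for v :: 'a
    unfolding power2_norm_eq_inner by (subst euclidean_inner) (simp add: power2_eq_square)
  have "mm_cost lam x = (\<Sum>i\<in>UNIV. \<Sum>e\<in>Basis. lam i * (u i e \<bullet> x)\<^sup>2)" for x :: "'a ^ 'j"
    unfolding mm_cost_def norm_sq u sum_distrib_left ..
  then have "(\<integral>\<^sup>+x. ennreal (mm_cost lam x) \<partial>gauss_law p) =
     (\<integral>\<^sup>+x. (\<Sum>i\<in>UNIV. \<Sum>e\<in>Basis. ennreal (lam i) * ennreal ((u i e \<bullet> x)\<^sup>2)) \<partial>gauss_law p)"
    using lam by (simp add: sum_nonneg flip: ennreal_mult)
  also have "\<dots> = (\<Sum>i\<in>UNIV. \<Sum>e\<in>Basis. ennreal (lam i) * (\<integral>\<^sup>+x. ennreal ((u i e \<bullet> x)\<^sup>2) \<partial>gauss_law p))"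
    by (subst nn_integral_sum, simp, intro sum.cong refl, subst nn_integral_sum, simp,
        intro sum.cong refl, subst nn_integral_cmult, auto)
  also have "\<dots> = ennreal (gaussian_param_cost lam p)"
    using lam s by (simp add: gauss_law_second_moment[OF p] gaussian_param_cost_def Let_def u_def sum_nonneg
        del: ennreal_plus flip: ennreal_mult)
  finally show ?thesis .
qed

lemma mm_objective_gmix:
  assumes lam: "\<And>j. 0 \<le> lam j" and W: "set_pmf W \<subseteq> gaussian_params"
  shows "mm_objective lam (gmix W) = (\<integral>\<^sup>+p. ennreal (gaussian_param_cost lam p) \<partial>measure_pmf W)"
proof -
  have "mm_objective lam (gmix W) = (\<integral>\<^sup>+p. \<integral>\<^sup>+x. ennreal (mm_cost lam x) \<partial>gauss_law p \<partial>measure_pmf W)"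
    unfolding mm_objective_def by (rule nn_integral_gmix) simp
  also have "\<dots> = (\<integral>\<^sup>+p. ennreal (gaussian_param_cost lam p) \<partial>measure_pmf W)"
    by (intro nn_integral_cong_AE, unfold AE_measure_pmf_iff)
      (use W in \<open>blast intro: nn_integral_mm_cost_gauss_law[where lam=lam, OF lam]\<close>)
  finally show ?thesis .
qed

text \<open>
  By uniqueness of mixing distributions, the marginal constraints on a mixture are marginal
  constraints on its mixing distribution.
\<close>

lemma multi_couplings_gmix_iff:
  fixes W :: "(('a::euclidean_space ^ 'j::finite) \<times> _) pmf"
  assumes W: "finite (set_pmf W)" "set_pmf W \<subseteq> gaussian_params"
    and V: "\<And>j. finite (set_pmf (V j))" "\<And>j. set_pmf (V j) \<subseteq> gaussian_params"
  shows "gmix W \<in> multi_couplings (\<lambda>j. gmix (V j)) \<longleftrightarrow> (\<forall>j. map_pmf (push_param (\<lambda>x. x $ j)) W = V j)"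
proof -
  have "distr (gmix W) borel (\<lambda>x. x $ j) = gmix (V j) \<longleftrightarrow> map_pmf (push_param (\<lambda>x. x $ j)) W = V j" for j
  proof -
    have "set_pmf (map_pmf (push_param (\<lambda>x. x $ j)) W) \<subseteq> gaussian_params"
      unfolding set_map_pmf using push_param_in_gaussian_params[OF linear_vec_component] W(2) by blast
    then show ?thesis
      unfolding distr_gmix[OF linear_vec_component W(2)]
      using gmix_inj[OF _ _ V(1,2), of "map_pmf (push_param (\<lambda>x. x $ j)) W" j] W(1) by auto
  qed
  then show ?thesis by (simp add: multi_couplings_def prob_space_gmix)
qed

text \<open>
  Every component of a plan can be exchanged for an optimal Gaussian coupling of its own marginals
  without raising the cost. It therefore suffices to minimize over the weights of tuples of
  components, with the optimal cost of a tuple as price.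
\<close>

lemma mm_optimal_plan_exists:
  fixes \<mu> :: "'j::finite \<Rightarrow> 'a::euclidean_space measure"
  assumes \<mu>: "\<And>j. \<mu> j \<in> GMM" and lam: "\<And>j. 0 \<le> lam j"
  shows "\<exists>\<gamma>. is_arg_min (mm_objective lam) (\<lambda>\<gamma>. \<gamma> \<in> multi_couplings \<mu> \<inter> GMM) \<gamma>"
proof -
  obtain V where V: "\<And>j. finite (set_pmf (V j))" "\<And>j. set_pmf (V j) \<subseteq> gaussian_params" "\<mu> = (\<lambda>j. gmix (V j))"
  proof -
    have "\<forall>j. \<exists>W. \<mu> j = gmix W \<and> finite (set_pmf W) \<and> set_pmf W \<subseteq> gaussian_params"
      using \<mu> by (auto simp: GMM_eq_gmix)
    then obtain V where "\<forall>j. \<mu> j = gmix (V j) \<and> finite (set_pmf (V j)) \<and> set_pmf (V j) \<subseteq> gaussian_params"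
      by (rule choice[THEN exE])
    then show ?thesis by (intro that[of V]) auto
  qed
  let ?feas = "\<lambda>(p :: 'j \<Rightarrow> 'a \<times> ('a \<Rightarrow> 'a)) (r :: ('a ^ 'j) \<times> ('a ^ 'j \<Rightarrow> 'a ^ 'j)). \<forall>j. push_param (\<lambda>x. x $ j) r = p j"
  have cont: "continuous_on UNIV (\<lambda>S. gaussian_param_cost lam (m, S))" for m :: "'a ^ 'j"
    unfolding gaussian_param_cost_def Let_def by (intro continuous_intros) simp
  let ?opt = "\<lambda>p r. r \<in> gaussian_params \<and> ?feas p r \<and>
    (\<forall>r'\<in>gaussian_params. ?feas p r' \<longrightarrow> gaussian_param_cost lam r \<le> gaussian_param_cost lam r')"
  define r where "r = (\<lambda>p. SOME r. ?opt p r)"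
  have r: "?opt p (r p)" if "\<And>j. p j \<in> gaussian_params" for p
  proof -
    have "\<exists>r. ?opt p r"
      using optimal_gaussian_param_coupling[where p=p and F="gaussian_param_cost lam", OF that cont] by blast
    then show ?thesis unfolding r_def by (rule someI_ex)
  qed
  have cost_nonneg: "0 \<le> gaussian_param_cost lam q" if "q \<in> gaussian_params" for q :: "('a ^ 'j) \<times> _"
    unfolding gaussian_param_cost_def Let_def using that lam
    by (intro sum_nonneg mult_nonneg_nonneg add_nonneg_nonneg) (auto simp: gaussian_params_def covariance_operatorD)
  \<comment> \<open>The maximum only matters for tuples with invalid parameters, where \<open>r\<close> is arbitrary.\<close>
  define c where "c = (\<lambda>p. max 0 (gaussian_param_cost lam (r p)))"
  obtain U where U: "\<And>j. map_pmf (\<lambda>t. t j) U = V j"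
    and U_min: "\<And>U'. (\<And>j. map_pmf (\<lambda>t. t j) U' = V j) \<Longrightarrow>
      (\<integral>\<^sup>+t. ennreal (c t) \<partial>measure_pmf U) \<le> (\<integral>\<^sup>+t. ennreal (c t) \<partial>measure_pmf U')"
    using optimal_pmf_coupling[where \<mu>=V and c=c, OF V(1)] by (auto simp: c_def)
  have U_supp: "t j \<in> set_pmf (V j)" if "t \<in> set_pmf U" for t j
    using that unfolding U[of j, symmetric] by auto
  then have U_gp: "t j \<in> gaussian_params" if "t \<in> set_pmf U" for t j using that V(2) by blast
  define W where "W = map_pmf r U"
  have W_gp: "set_pmf W \<subseteq> gaussian_params" using r U_gp by (auto simp: W_def)
  have "finite (set_pmf U)"
  proof (rule finite_subset)
    show "set_pmf U \<subseteq> PiE UNIV (\<lambda>j. set_pmf (V j))" using U_supp by auto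
    show "finite (PiE UNIV (\<lambda>j. set_pmf (V j)))" by (rule finite_PiE) (auto simp: V)
  qed
  then have W_fin: "finite (set_pmf W)" by (simp add: W_def)
  have "map_pmf (push_param (\<lambda>x. x $ j)) W = V j" for j
  proof -
    have "map_pmf (push_param (\<lambda>x. x $ j)) W = map_pmf (\<lambda>t. t j) U"
      unfolding W_def pmf.map_comp o_def using r U_gp by (intro map_pmf_cong refl) blast
    then show ?thesis by (simp add: U)
  qed
  then have W_mc: "gmix W \<in> multi_couplings \<mu>"
    unfolding V(3) by (subst multi_couplings_gmix_iff[where V=V, OF W_fin W_gp V(1,2)]) blast
  have W_obj: "mm_objective lam (gmix W) \<le> (\<integral>\<^sup>+t. ennreal (c t) \<partial>measure_pmf U)"
    unfolding mm_objective_gmix[where lam=lam, OF lam W_gp] by (simp add: W_def c_def nn_integral_mono ennreal_leI)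
  have "mm_objective lam (gmix W) \<le> mm_objective lam \<gamma>" if \<gamma>: "\<gamma> \<in> multi_couplings \<mu> \<inter> GMM" for \<gamma>
  proof -
    obtain W' where W': "finite (set_pmf W')" "set_pmf W' \<subseteq> gaussian_params" "\<gamma> = gmix W'"
      using \<gamma> by (auto simp: GMM_eq_gmix)
    then have m: "map_pmf (push_param (\<lambda>x. x $ j)) W' = V j" for j
      using \<gamma> multi_couplings_gmix_iff[where V=V, OF W'(1,2) V(1,2)] by (simp add: V(3))
    define \<tau> where "\<tau> = (\<lambda>q :: ('a ^ 'j) \<times> ('a ^ 'j \<Rightarrow> 'a ^ 'j). \<lambda>j. push_param (\<lambda>x. x $ j) q)"
    have "mm_objective lam (gmix W) \<le> (\<integral>\<^sup>+t. ennreal (c t) \<partial>measure_pmf (map_pmf \<tau> W'))"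
      by (rule order_trans[OF W_obj U_min]) (simp add: pmf.map_comp o_def \<tau>_def m)
    also have "\<dots> = (\<integral>\<^sup>+q. ennreal (c (\<tau> q)) \<partial>measure_pmf W')" by simp
    also have "\<dots> \<le> (\<integral>\<^sup>+q. ennreal (gaussian_param_cost lam q) \<partial>measure_pmf W')"
    proof (intro nn_integral_mono_AE, unfold AE_measure_pmf_iff, intro ballI ennreal_leI)
      fix q assume "q \<in> set_pmf W'"
      then have q: "q \<in> gaussian_params" using W' by blast
      have "\<tau> q j \<in> gaussian_params" for j unfolding \<tau>_def by (rule push_param_in_gaussian_params[OF linear_vec_component q])
      from r[OF this] q have "gaussian_param_cost lam (r (\<tau> q)) \<le> gaussian_param_cost lam q" by (simp add: \<tau>_def)
      then show "c (\<tau> q) \<le> gaussian_param_cost lam q" using cost_nonneg[OF q] by (simp add: c_def)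
    qed
    also have "\<dots> = mm_objective lam \<gamma>" by (simp add: W'(3) mm_objective_gmix[where lam=lam, OF lam W'(2)])
    finally show ?thesis .
  qed
  then have "is_arg_min (mm_objective lam) (\<lambda>\<gamma>. \<gamma> \<in> multi_couplings \<mu> \<inter> GMM) (gmix W)"
    using W_mc W_fin W_gp by (auto simp: is_arg_min_def GMM_eq_gmix not_less)
  then show ?thesis by blast
qed

section \<open>Barycenters from multi-marginal plans\<close>

lemma GMM_distr_linear:
  fixes L :: "'a::euclidean_space \<Rightarrow> 'b::euclidean_space"
  assumes L: "linear L" and M: "M \<in> GMM"
  shows "distr M borel L \<in> GMM"
proof -
  obtain W where W: "finite (set_pmf W)" "set_pmf W \<subseteq> gaussian_params" "M = gmix W"
    using M by (auto simp: GMM_eq_gmix)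
  have "set_pmf (map_pmf (push_param L) W) \<subseteq> gaussian_params"
    unfolding set_map_pmf using push_param_in_gaussian_params[OF L] W(2) by blast
  moreover have "finite (set_pmf (map_pmf (push_param L) W))" using W(1) by simp
  ultimately show ?thesis unfolding W(3) distr_gmix[OF L W(2)] GMM_eq_gmix by blast
qed

lemma GMM_sets: "M \<in> GMM \<Longrightarrow> sets M = sets borel"
  and GMM_prob_space: "M \<in> GMM \<Longrightarrow> prob_space M"
  by (auto simp: GMM_eq_gmix prob_space_gmix)

text \<open>
  All \<open>\<gamma> j\<close> have the same second marginal; identifiability makes the second
  marginals of their mixing distributions equal as well, and these are then glued tuple by tuple.
\<close>

lemma glue_GMM_couplings:
  fixes \<gamma> :: "'j::finite \<Rightarrow> ('a::euclidean_space \<times> 'a) measure"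
  assumes \<gamma>: "\<And>j. \<gamma> j \<in> couplings (\<mu> j) \<nu> \<inter> GMM" and \<nu>: "\<nu> \<in> GMM"
  shows "\<exists>\<Gamma>\<in>GMM. \<forall>j. distr \<Gamma> borel (\<lambda>x. (fst x $ j, snd x)) = \<gamma> j"
proof -
  have "\<forall>j. \<exists>W. finite (set_pmf W) \<and> set_pmf W \<subseteq> gaussian_params \<and> \<gamma> j = gmix W"
    using \<gamma> by (auto simp: GMM_eq_gmix)
  then obtain V where V: "\<And>j. finite (set_pmf (V j))" "\<And>j. set_pmf (V j) \<subseteq> gaussian_params" "\<And>j. \<gamma> j = gmix (V j)"
    by metis
  obtain U where U: "finite (set_pmf U)" "set_pmf U \<subseteq> gaussian_params" "\<nu> = gmix U"
    using \<nu> by (auto simp: GMM_eq_gmix)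
  have m: "map_pmf (push_param snd) (V j) = U" for j
  proof (rule gmix_inj[OF _ _ U(1,2)])
    show "finite (set_pmf (map_pmf (push_param snd) (V j)))" using V(1) by simp
    show "set_pmf (map_pmf (push_param snd) (V j)) \<subseteq> gaussian_params"
      unfolding set_map_pmf using push_param_in_gaussian_params[OF linear_snd] V(2)[of j] by blast
    show "gmix (map_pmf (push_param snd) (V j)) = gmix U"
      unfolding distr_gmix[OF linear_snd V(2), symmetric] V(3)[symmetric] U(3)[symmetric]
      using \<gamma>[of j] by (simp add: couplings_def)
  qed
  have K: "linear (\<lambda>x :: ('a ^ 'j) \<times> 'a. (fst x $ j, snd x))" for j
    by (rule linearI) simp_all
  have "\<exists>W. finite (set_pmf W) \<and> set_pmf W \<subseteq> gaussian_params \<and>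
      (\<forall>j. map_pmf (push_param (\<lambda>x :: ('a ^ 'j) \<times> 'a. (fst x $ j, snd x))) W = V j)"
  proof (rule glue_pmf[where f="push_param snd" and U=U])
    fix q p assume p: "\<And>j. p j \<in> set_pmf (V j)" "\<And>j. push_param snd (p j) = q"
    show "\<exists>r\<in>gaussian_params. \<forall>j. push_param (\<lambda>x :: ('a ^ 'j) \<times> 'a. (fst x $ j, snd x)) r = p j"
    proof (rule glue_gaussian_params)
      show "p j \<in> gaussian_params" for j using p(1)[of j] V(2)[of j] by blast
    qed (rule p(2))
  qed (rule m V(1))+
  then obtain W where W: "finite (set_pmf W)" "set_pmf W \<subseteq> gaussian_params"
    "\<And>j. map_pmf (push_param (\<lambda>x :: ('a ^ 'j) \<times> 'a. (fst x $ j, snd x))) W = V j"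
    by blast
  have "gmix W \<in> GMM" using W by (auto simp: GMM_eq_gmix)
  moreover have "distr (gmix W) borel (\<lambda>x. (fst x $ j, snd x)) = \<gamma> j" for j
    unfolding distr_gmix[OF K W(2)] W(3) V(3) ..
  ultimately show ?thesis by blast
qed

text \<open>
  The bias--variance decomposition: the difference of the two sides is
  \<open>|B x - y|\<^sup>2\<close>.
\<close>

lemma mm_cost_le_second_moment:
  fixes x :: "'a::euclidean_space ^ 'j::finite"
  assumes "\<And>j. 0 \<le> lam j" "(\<Sum>j\<in>UNIV. lam j) = 1"
  shows "mm_cost lam x \<le> (\<Sum>j\<in>UNIV. lam j * (norm (x $ j - y))\<^sup>2)"
proof -
  define b where "b = bary lam x"
  have lb: "(\<Sum>i\<in>UNIV. lam i * (x $ i \<bullet> z)) = b \<bullet> z" for z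
    by (simp add: b_def bary_def inner_sum_left)
  have "(\<Sum>j\<in>UNIV. lam j * (norm (x $ j - y))\<^sup>2) =
      (\<Sum>j\<in>UNIV. lam j * (norm (x $ j - b))\<^sup>2 + 2 * (lam j * (x $ j \<bullet> (b - y)))
        + lam j * (y \<bullet> y - b \<bullet> b))"
    by (intro sum.cong) (auto simp: power2_norm_eq_inner inner_diff inner_commute algebra_simps)
  also have "\<dots> = mm_cost lam x + 2 * (b \<bullet> (b - y)) + (y \<bullet> y - b \<bullet> b)"
    by (simp add: sum.distrib lb assms mm_cost_def b_def[symmetric]
        flip: sum_distrib_left sum_distrib_right)
  also have "\<dots> = mm_cost lam x + (norm (b - y))\<^sup>2"
    by (simp add: power2_norm_eq_inner inner_diff inner_commute)
  finally show ?thesis by simp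
qed

text \<open>
  Integrate the inequality between the cost of \<open>x\<close> and the weighted second moment
  about \<open>y\<close> against a glued plan.
\<close>

lemma mm_objective_le_couplings:
  fixes \<gamma> :: "('a::euclidean_space ^ 'j::finite) measure" and \<delta> :: "'j \<Rightarrow> ('a \<times> 'a) measure"
  assumes opt: "\<And>\<gamma>'. \<gamma>' \<in> multi_couplings \<mu> \<inter> GMM \<Longrightarrow> mm_objective lam \<gamma> \<le> mm_objective lam \<gamma>'"
    and lam: "\<And>j. 0 \<le> lam j" "(\<Sum>j\<in>UNIV. lam j) = 1"
    and \<delta>: "\<And>j. \<delta> j \<in> couplings (\<mu> j) \<nu> \<inter> GMM" and \<nu>: "\<nu> \<in> GMM"
  shows "mm_objective lam \<gamma> \<le>
    (\<Sum>j\<in>UNIV. ennreal (lam j) * (\<integral>\<^sup>+y. ennreal ((norm (fst y - snd y))\<^sup>2) \<partial>\<delta> j))"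
proof -
  obtain \<Gamma> :: "(('a ^ 'j) \<times> 'a) measure" where \<Gamma>: "\<Gamma> \<in> GMM"
    "\<And>j. distr \<Gamma> borel (\<lambda>x. (fst x $ j, snd x)) = \<delta> j"
    using glue_GMM_couplings[where \<gamma>=\<delta> and \<mu>=\<mu>, OF \<delta> \<nu>] by blast
  note [measurable_cong] = GMM_sets[OF \<Gamma>(1)]
  have K[measurable]: "(\<lambda>x :: ('a ^ 'j) \<times> 'a. (fst x $ j, snd x)) \<in> borel_measurable borel" for j
    by (rule borel_measurable_linear, rule linearI) simp_all
  have fst_m[measurable]: "(fst :: ('a ^ 'j) \<times> 'a \<Rightarrow> _) \<in> borel_measurable borel"
    by (rule borel_measurable_linear[OF linear_fst])
  have nth_m[measurable]: "(\<lambda>x :: 'a ^ 'j. x $ j) \<in> borel_measurable borel" for j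
    by (rule borel_measurable_linear[OF linear_vec_component])
  have d_m[measurable]: "(\<lambda>y :: 'a \<times> 'a. (norm (fst y - snd y))\<^sup>2) \<in> borel_measurable borel"
    by (intro borel_measurable_continuous_onI continuous_intros)
  have "distr (distr \<Gamma> borel fst) borel (\<lambda>x. x $ j) = \<mu> j" for j
  proof -
    have "distr (distr \<Gamma> borel fst) borel (\<lambda>x. x $ j) = distr (distr \<Gamma> borel (\<lambda>x. (fst x $ j, snd x))) borel fst"
      by (subst (1 2) distr_distr) (auto simp: o_def borel_measurable_linear[OF linear_fst])
    also have "\<dots> = \<mu> j" using \<delta>[of j] by (simp add: \<Gamma>(2) couplings_def)
    finally show ?thesis .
  qed
  then have mc: "distr \<Gamma> borel fst \<in> multi_couplings \<mu> \<inter> GMM"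
    using GMM_distr_linear[OF linear_fst \<Gamma>(1)]
    by (auto simp: multi_couplings_def intro: GMM_prob_space)
  have "mm_objective lam \<gamma> \<le> mm_objective lam (distr \<Gamma> borel fst)" by (rule opt[OF mc])
  also have "\<dots> = (\<integral>\<^sup>+x. ennreal (mm_cost lam (fst x)) \<partial>\<Gamma>)"
    unfolding mm_objective_def by (subst nn_integral_distr) auto
  also have "\<dots> \<le> (\<integral>\<^sup>+x. (\<Sum>j\<in>UNIV. ennreal (lam j) * ennreal ((norm (fst x $ j - snd x))\<^sup>2)) \<partial>\<Gamma>)"
  proof (intro nn_integral_mono)
    fix x :: "('a ^ 'j) \<times> 'a"
    have "ennreal (mm_cost lam (fst x)) \<le> ennreal (\<Sum>j\<in>UNIV. lam j * (norm (fst x $ j - snd x))\<^sup>2)"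
      by (intro ennreal_leI mm_cost_le_second_moment lam)
    then show "ennreal (mm_cost lam (fst x)) \<le> (\<Sum>j\<in>UNIV. ennreal (lam j) * ennreal ((norm (fst x $ j - snd x))\<^sup>2))"
      using lam by (simp flip: ennreal_mult)
  qed
  also have "\<dots> = (\<Sum>j\<in>UNIV. ennreal (lam j) * (\<integral>\<^sup>+x. ennreal ((norm (fst x $ j - snd x))\<^sup>2) \<partial>\<Gamma>))"
  proof -
    have [measurable]: "(\<lambda>x :: ('a ^ 'j) \<times> 'a. (norm (fst x $ j - snd x))\<^sup>2) \<in> borel_measurable borel" for j
      using measurable_compose[OF K d_m, of j] by simp
    show ?thesis by (simp add: nn_integral_sum nn_integral_cmult)
  qed
  also have "\<dots> = (\<Sum>j\<in>UNIV. ennreal (lam j) * (\<integral>\<^sup>+y. ennreal ((norm (fst y - snd y))\<^sup>2) \<partial>\<delta> j))"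
    unfolding \<Gamma>(2)[symmetric] by (subst nn_integral_distr) auto
  finally show ?thesis .
qed

text \<open>
  The infima defining \<open>MW2_squared\<close> are approximated by couplings, to which the
  previous lemma applies; an infinite value makes the claim trivial because the weights are
  positive.
\<close>

lemma mm_objective_le_barycenter_objective:
  fixes \<gamma> :: "('a::euclidean_space ^ 'j::finite) measure" and \<nu> :: "'a measure"
  assumes opt: "\<And>\<gamma>'. \<gamma>' \<in> multi_couplings \<mu> \<inter> GMM \<Longrightarrow> mm_objective lam \<gamma> \<le> mm_objective lam \<gamma>'"
    and lam: "\<And>j. 0 < lam j" "(\<Sum>j\<in>UNIV. lam j) = 1" and \<nu>: "\<nu> \<in> GMM"
  shows "mm_objective lam \<gamma> \<le> barycenter_objective lam \<mu> \<nu>"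
proof (cases "\<exists>j. MW2_squared (\<mu> j) \<nu> = \<infinity>")
  case True
  then obtain j where "MW2_squared (\<mu> j) \<nu> = \<infinity>" by blast
  then have "ennreal (lam j) * MW2_squared (\<mu> j) \<nu> = top"
    using lam(1)[of j] by (simp add: ennreal_mult_eq_top_iff)
  then have "barycenter_objective lam \<mu> \<nu> = top"
    unfolding barycenter_objective_def by (auto intro: bexI[of _ j])
  then show ?thesis by simp
next
  case False
  show ?thesis
  proof (rule ennreal_le_epsilon)
    fix e :: real assume e: "0 < e"
    have "\<exists>\<delta>\<in>couplings (\<mu> j) \<nu> \<inter> GMM.
       (\<integral>\<^sup>+y. ennreal ((norm (fst y - snd y))\<^sup>2) \<partial>\<delta>) < MW2_squared (\<mu> j) \<nu> + ennreal e" for j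
    proof -
      have "MW2_squared (\<mu> j) \<nu> < MW2_squared (\<mu> j) \<nu> + ennreal e"
        using False e by (simp add: ennreal_add_left_cancel_less less_top)
      then show ?thesis unfolding MW2_squared_def[of "\<mu> j" \<nu>] by (subst (asm) (1) INF_less_iff)
    qed
    then obtain \<delta> where \<delta>: "\<And>j. \<delta> j \<in> couplings (\<mu> j) \<nu> \<inter> GMM"
       "\<And>j. (\<integral>\<^sup>+y. ennreal ((norm (fst y - snd y))\<^sup>2) \<partial>\<delta> j) < MW2_squared (\<mu> j) \<nu> + ennreal e"
      by metis
    have "mm_objective lam \<gamma> \<le>
        (\<Sum>j\<in>UNIV. ennreal (lam j) * (\<integral>\<^sup>+y. ennreal ((norm (fst y - snd y))\<^sup>2) \<partial>\<delta> j))"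
      by (rule mm_objective_le_couplings[where lam=lam and \<mu>=\<mu> and \<delta>=\<delta> and \<gamma>=\<gamma>, OF opt less_imp_le[OF lam(1)] lam(2) \<delta>(1) \<nu>])
    also have "\<dots> \<le> (\<Sum>j\<in>UNIV. ennreal (lam j) * (MW2_squared (\<mu> j) \<nu> + ennreal e))"
      by (intro sum_mono mult_left_mono less_imp_le[OF \<delta>(2)]) simp
    also have "\<dots> = barycenter_objective lam \<mu> \<nu> + (\<Sum>j\<in>UNIV. ennreal (lam j)) * ennreal e"
      by (simp add: barycenter_objective_def distrib_left sum.distrib sum_distrib_right)
    also have "(\<Sum>j\<in>UNIV. ennreal (lam j)) = 1"
      using lam by (simp add: less_imp_le)
    finally show "mm_objective lam \<gamma> \<le> barycenter_objective lam \<mu> \<nu> + ennreal e" by simp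
  qed
qed

text \<open>
  The image of \<open>\<gamma>\<close> under \<open>x \<mapsto> (x\<^sub>j, B x)\<close> competes
  in the problem between \<open>\<mu> j\<close> and the image of \<open>\<gamma>\<close> under
  \<open>B\<close>.
\<close>

lemma barycenter_objective_bary_le:
  fixes \<gamma> :: "('a::euclidean_space ^ 'j::finite) measure"
  assumes \<gamma>: "\<gamma> \<in> multi_couplings \<mu> \<inter> GMM" and lam: "\<And>j. 0 \<le> lam j"
  shows "barycenter_objective lam \<mu> (distr \<gamma> borel (bary lam)) \<le> mm_objective lam \<gamma>"
proof -
  have s: "sets \<gamma> = sets borel" using GMM_sets[of \<gamma>] \<gamma> by blast
  note [measurable_cong] = s
  have K: "linear (\<lambda>x :: 'a ^ 'j. (x $ j, bary lam x))" for j
    by (rule linearI) (simp_all add: linear_add[OF linear_bary] linear_scale[OF linear_bary])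
  note Km[measurable] = borel_measurable_linear[OF K]
  have d_m[measurable]: "(\<lambda>y :: 'a \<times> 'a. (norm (fst y - snd y))\<^sup>2) \<in> borel_measurable borel"
    by (intro borel_measurable_continuous_onI continuous_intros)
  have MW: "MW2_squared (\<mu> j) (distr \<gamma> borel (bary lam)) \<le> (\<integral>\<^sup>+x. ennreal ((norm (x $ j - bary lam x))\<^sup>2) \<partial>\<gamma>)" for j
  proof -
    let ?\<delta> = "distr \<gamma> borel (\<lambda>x. (x $ j, bary lam x))"
    have G: "?\<delta> \<in> GMM" using \<gamma> by (intro GMM_distr_linear[OF K]) simp
    have "distr ?\<delta> borel fst = \<mu> j" "distr ?\<delta> borel snd = distr \<gamma> borel (bary lam)"
      using \<gamma> by (auto simp: multi_couplings_def distr_distr o_def borel_measurable_linear[OF linear_fst]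
         borel_measurable_linear[OF linear_snd])
    then have "?\<delta> \<in> couplings (\<mu> j) (distr \<gamma> borel (bary lam))"
      using GMM_prob_space[OF G] by (simp add: couplings_def)
    then have "MW2_squared (\<mu> j) (distr \<gamma> borel (bary lam)) \<le>
        (\<integral>\<^sup>+y. ennreal ((norm (fst y - snd y))\<^sup>2) \<partial>?\<delta>)"
      unfolding MW2_squared_def using G by (intro INF_lower) simp
    also have "\<dots> = (\<integral>\<^sup>+x. ennreal ((norm (x $ j - bary lam x))\<^sup>2) \<partial>\<gamma>)"
      by (subst nn_integral_distr) auto
    finally show ?thesis .
  qed
  have [measurable]: "(\<lambda>x :: 'a ^ 'j. (norm (x $ j - bary lam x))\<^sup>2) \<in> borel_measurable borel" for j
    using measurable_compose[OF Km d_m, of j] by simp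
  have "barycenter_objective lam \<mu> (distr \<gamma> borel (bary lam)) \<le>
      (\<Sum>j\<in>UNIV. ennreal (lam j) * (\<integral>\<^sup>+x. ennreal ((norm (x $ j - bary lam x))\<^sup>2) \<partial>\<gamma>))"
    unfolding barycenter_objective_def by (intro sum_mono mult_left_mono MW) simp
  also have "\<dots> = (\<integral>\<^sup>+x. (\<Sum>j\<in>UNIV. ennreal (lam j) * ennreal ((norm (x $ j - bary lam x))\<^sup>2)) \<partial>\<gamma>)"
    by (simp add: nn_integral_sum nn_integral_cmult)
  also have "\<dots> = mm_objective lam \<gamma>"
    unfolding mm_objective_def mm_cost_def using lam by (simp flip: ennreal_mult)
  finally show ?thesis .
qed

theorem proposition8:
  fixes \<mu> :: "'j::finite \<Rightarrow> (real ^ 'd) measure" and lam :: "'j \<Rightarrow> real"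
  assumes "CARD('j) \<ge> 2"
    and "\<forall>j. \<mu> j \<in> GMM"
    and "\<forall>j. lam j > 0"
    and "(\<Sum>j\<in>UNIV. lam j) = 1"
  shows "(\<exists>\<gamma>. is_arg_min (mm_objective lam) (\<lambda>\<gamma>. \<gamma> \<in> multi_couplings \<mu> \<inter> GMM) \<gamma>) \<and>
    (\<forall>\<gamma>. is_arg_min (mm_objective lam) (\<lambda>\<gamma>. \<gamma> \<in> multi_couplings \<mu> \<inter> GMM) \<gamma> \<longrightarrow>
       is_arg_min (barycenter_objective lam \<mu>) (\<lambda>\<nu>. \<nu> \<in> GMM) (distr \<gamma> borel (bary lam)))"
proof (intro conjI allI impI)
  have lam: "0 < lam j" "0 \<le> lam j" for j using assms(3) by (auto intro: less_imp_le)
  show "\<exists>\<gamma>. is_arg_min (mm_objective lam) (\<lambda>\<gamma>. \<gamma> \<in> multi_couplings \<mu> \<inter> GMM) \<gamma>"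
    using assms(2) lam(2) by (intro mm_optimal_plan_exists) auto
  fix \<gamma> assume "is_arg_min (mm_objective lam) (\<lambda>\<gamma>. \<gamma> \<in> multi_couplings \<mu> \<inter> GMM) \<gamma>"
  then have \<gamma>: "\<gamma> \<in> multi_couplings \<mu> \<inter> GMM"
    and opt: "\<And>\<gamma>'. \<gamma>' \<in> multi_couplings \<mu> \<inter> GMM \<Longrightarrow> mm_objective lam \<gamma> \<le> mm_objective lam \<gamma>'"
    by (auto simp: is_arg_min_def not_less)
  have "distr \<gamma> borel (bary lam) \<in> GMM"
    using \<gamma> by (intro GMM_distr_linear linear_bary) simp
  moreover have "barycenter_objective lam \<mu> (distr \<gamma> borel (bary lam)) \<le> barycenter_objective lam \<mu> \<nu>"
    if "\<nu> \<in> GMM" for \<nu>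
    using barycenter_objective_bary_le[where lam=lam, OF \<gamma> lam(2)]
      mm_objective_le_barycenter_objective[where lam=lam and \<mu>=\<mu>, OF opt lam(1) assms(4) that]
    by (rule order_trans)
  ultimately show "is_arg_min (barycenter_objective lam \<mu>) (\<lambda>\<nu>. \<nu> \<in> GMM) (distr \<gamma> borel (bary lam))"
    by (simp add: is_arg_min_def not_less)
qed

end
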